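(* Let $K$ be a field with $\operatorname{char}K\neq 2$, let $D\in K^\times$, and let $M$ be the cyclic Galois module of order $4$ corresponding to the quadratic extension $K[\sqrt{D}]$, i.e. $M=\mathbb{Z}/4\mathbb{Z}$ with $g\in G_K$ acting by multiplication by $\chi_D(g)=g(\sqrt{D})/\sqrt{D}\in\{\pm1\}$. Then there is a group isomorphism $$H^1(K,M)\cong\{(\alpha,c)\in K[\sqrt{-D}]^\times\times K^\times : N(\alpha)=c^4\}\big/\{(\beta^4,N(\beta)) : \beta\in K[\sqrt{-D}]^\times\}$$ in which the coclass corresponding to a pair $(a+b\sqrt{-D},c)$ ($a,b,c\in K$) has corresponding quartic algebra $$L=K\Big[\sqrt{2a+2c^2},\ \sqrt{2c+\sqrt{2a+2c^2}}\Big].$$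
   Context: $N$ denotes the norm from $K[\sqrt{-D}]=K[X]/(X^2+D)$ to $K$. $K^{\mathrm{sep}}$ is a separable closure and $G_K$ its absolute Galois group. The quartic algebra $L$ is the iterated adjunction $K[u,v]/(u^2-(2a+2c^2),\,v^2-(2c+u))$. The correspondence between $H^1(K,M)$ and quartic étale algebras is: a coclass represented by a crossed homomorphism $\sigma:G_K\to M$ (i.e. $\sigma(gh)=\sigma(g)+g\sigma(h)$) corresponds to the étale algebra $L$ of degree $4$ whose coordinates ($K$-algebra maps $L\to K^{\mathrm{sep}}$) admit a labeling $\{\iota_x\}_{x\in M}$ with $g\circ\iota_x=\iota_{gx+\sigma(g)}$ for all $g\in G_K$; i.e. $L$ is the $\operatorname{Hol}(\mathbb{Z}/4)\cong D_4$-extension associated to $g\mapsto(x\mapsto gx+\sigma(g))$.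
   Formalization: The claim about L is made only for pairs for which L is étale of degree 4, i.e. has exactly four coordinates in K^sep; this excludes just the pairs with a = ±c² (so b = 0), such as (1,1), where L is not étale and the claim fails. *)

theory Defs
  imports "HOL-Algebra.Coset" "HOL-Computational_Algebra.Polynomial_Factorial"
          "HOL-Library.Numeral_Type"
begin

definition sep_poly :: "'a::field poly \<Rightarrow> bool" where
  "sep_poly p \<longleftrightarrow> coprime p (pderiv p)"

definition field_emb :: "('k::field \<Rightarrow> 'o::field) \<Rightarrow> bool" where
  "field_emb e \<longleftrightarrow> e 1 = 1 \<and> (\<forall>x y. e (x + y) = e x + e y) \<and> (\<forall>x y. e (x * y) = e x * e y)"

definition is_sep_closure :: "('k::field \<Rightarrow> 'o::field) \<Rightarrow> bool" where
  "is_sep_closure e \<longleftrightarrow> field_emb e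
     \<and> (\<forall>x::'o. \<exists>p::'k poly. p \<noteq> 0 \<and> sep_poly p \<and> poly (map_poly e p) x = 0)
     \<and> (\<forall>q::'o poly. degree q > 0 \<and> sep_poly q \<longrightarrow> (\<exists>x. poly q x = 0))"

definition galK :: "('k \<Rightarrow> 'o::field) \<Rightarrow> ('o \<Rightarrow> 'o) set" where
  "galK e = {g. bij g \<and> (\<forall>x y. g (x + y) = g x + g y) \<and> (\<forall>x y. g (x * y) = g x * g y)
                 \<and> (\<forall>k. g (e k) = e k)}"

text \<open>The quadratic character chi_D(g) = g(sqrt D)/sqrt D in {1,-1}, valued in Z/4.\<close>
definition chiD :: "('k \<Rightarrow> 'o::field) \<Rightarrow> 'k \<Rightarrow> ('o \<Rightarrow> 'o) \<Rightarrow> 4" where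
  "chiD e D g = (if (\<forall>r. r ^ 2 = e D \<longrightarrow> g r = r) then 1 else -1)"

text \<open>Continuous crossed homomorphisms G_K -> M (extensional: 0 outside G_K).
  Continuity for the Krull topology: sigma vanishes on the pointwise stabiliser of a
  finite subset of Omega (an open subgroup).\<close>
definition Z1 :: "('k \<Rightarrow> 'o::field) \<Rightarrow> 'k \<Rightarrow> (('o \<Rightarrow> 'o) \<Rightarrow> 4) set" where
  "Z1 e D = {\<sigma>. (\<forall>g. g \<notin> galK e \<longrightarrow> \<sigma> g = 0)
     \<and> (\<forall>g\<in>galK e. \<forall>h\<in>galK e. \<sigma> (g \<circ> h) = \<sigma> g + chiD e D g * \<sigma> h)
     \<and> (\<exists>S. finite S \<and> (\<forall>g\<in>galK e. (\<forall>s\<in>S. g s = s) \<longrightarrow> \<sigma> g = 0))}"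

definition B1 :: "('k \<Rightarrow> 'o::field) \<Rightarrow> 'k \<Rightarrow> (('o \<Rightarrow> 'o) \<Rightarrow> 4) set" where
  "B1 e D = {(\<lambda>g. if g \<in> galK e then chiD e D g * m - m else 0) | m. True}"

definition Z1_group :: "('k \<Rightarrow> 'o::field) \<Rightarrow> 'k \<Rightarrow> (('o \<Rightarrow> 'o) \<Rightarrow> 4) monoid" where
  "Z1_group e D = \<lparr>carrier = Z1 e D, monoid.mult = (\<lambda>\<sigma> \<tau> g. \<sigma> g + \<tau> g), one = (\<lambda>g. 0)\<rparr>"

definition H1 :: "('k \<Rightarrow> 'o::field) \<Rightarrow> 'k \<Rightarrow> (('o \<Rightarrow> 'o) \<Rightarrow> 4) set monoid" where
  "H1 e D = Z1_group e D Mod B1 e D"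

text \<open>(a, b) represents a + b sqrt(-D).\<close>
definition qmul :: "'k::field \<Rightarrow> 'k \<times> 'k \<Rightarrow> 'k \<times> 'k \<Rightarrow> 'k \<times> 'k" where
  "qmul D x y = (fst x * fst y - D * snd x * snd y, fst x * snd y + snd x * fst y)"

definition qnorm :: "'k::field \<Rightarrow> 'k \<times> 'k \<Rightarrow> 'k" where
  "qnorm D x = fst x ^ 2 + D * snd x ^ 2"

definition qpow4 :: "'k::field \<Rightarrow> 'k \<times> 'k \<Rightarrow> 'k \<times> 'k" where
  "qpow4 D x = qmul D (qmul D x x) (qmul D x x)"

definition qunits :: "'k::field \<Rightarrow> ('k \<times> 'k) set" where
  "qunits D = {x. qnorm D x \<noteq> 0}"

definition pair_group :: "'k::field \<Rightarrow> (('k \<times> 'k) \<times> 'k) monoid" where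
  "pair_group D = \<lparr>carrier = {(\<alpha>, c). \<alpha> \<in> qunits D \<and> c \<noteq> 0 \<and> qnorm D \<alpha> = c ^ 4},
     monoid.mult = (\<lambda>p q. (qmul D (fst p) (fst q), snd p * snd q)),
     one = ((1, 0), 1)\<rparr>"

definition pair_sub :: "'k::field \<Rightarrow> (('k \<times> 'k) \<times> 'k) set" where
  "pair_sub D = {(qpow4 D \<beta>, qnorm D \<beta>) | \<beta>. \<beta> \<in> qunits D}"

definition pair_quot :: "'k::field \<Rightarrow> (('k \<times> 'k) \<times> 'k) set monoid" where
  "pair_quot D = pair_group D Mod pair_sub D"

text \<open>K-algebra maps L -> Omega are determined by the images (u, v) of the generators,
  which range exactly over the solutions of the defining relations.\<close>
definition L_coords :: "('k::field \<Rightarrow> 'o::field) \<Rightarrow> 'k \<Rightarrow> 'k \<Rightarrow> ('o \<times> 'o) set" where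
  "L_coords e a c = {(u, v). u ^ 2 = e (2 * a + 2 * c ^ 2) \<and> v ^ 2 = e (2 * c) + u}"

text \<open>The coclass of sigma corresponds to the (etale) algebra with coordinates C:
  a labelling iota : M -> C, bijective, with g o iota_x = iota_(g x + sigma g).\<close>
definition corresponds :: "('k \<Rightarrow> 'o::field) \<Rightarrow> 'k \<Rightarrow> (('o \<Rightarrow> 'o) \<Rightarrow> 4) \<Rightarrow> ('o \<times> 'o) set \<Rightarrow> bool" where
  "corresponds e D \<sigma> C \<longleftrightarrow> (\<exists>\<iota> :: 4 \<Rightarrow> 'o \<times> 'o. bij_betw \<iota> UNIV C
      \<and> (\<forall>g\<in>galK e. \<forall>x. map_prod g g (\<iota> x) = \<iota> (chiD e D g * x + \<sigma> g)))"

end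

theory Submission
  imports Defs
begin

text \<open>Put \<open>r = sqrt (-D)\<close> and \<open>i = sqrt (-1)\<close>, so that \<open>i r\<close> is a square root of \<open>D\<close>. As a Galois
  module, \<open>M\<close> is the kernel of \<open>\<beta> \<mapsto> (\<beta>^4, N \<beta>)\<close> on the units of \<open>K^sep[sqrt (-D)]\<close>, whose first
  cohomology vanishes by Hilbert 90; the theorem is the resulting Kummer isomorphism. Concretely,
  given \<open>(\<alpha>, c)\<close> choose \<open>w\<close> with \<open>w^4 = \<alpha>\<close>; then \<open>c / w\<close> is a fourth root of the conjugate of \<open>\<alpha>\<close>,
  and the cocycle is read off from \<open>g w = i^(\<sigma> g) w\<close> if \<open>g r = r\<close> and \<open>g w = c / (i^(\<sigma> g) w)\<close>
  if \<open>g r = - r\<close>. The elements \<open>w + c / w\<close>, for \<open>w\<close> running through the four fourth roots of \<open>\<alpha>\<close>,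
  are the images of the generator \<open>v\<close> of the quartic algebra, and \<open>w^2 + (c / w)^2\<close> those of \<open>u\<close>.

  Injectivity and surjectivity use that only \<open>K\<close> is fixed by all automorphisms of the separable
  closure, which is proved by extending partial isomorphisms with Zorn's lemma.\<close>

section \<open>Separable polynomials\<close>

text \<open>Euclid's algorithm. The common divisor is produced directly as a linear combination, so
  that the argument works in any Euclidean ring without gcds.\<close>

lemma euclidean_bezout:
  fixes p q :: "'a::euclidean_ring"
  shows "\<exists>u v. (u * p + v * q) dvd p \<and> (u * p + v * q) dvd q"
proof (induction "euclidean_size q" arbitrary: p q rule: less_induct)
  case less
  show ?case
  proof (cases "q = 0")
    case True
    then have "1 * p + 0 * q dvd p \<and> 1 * p + 0 * q dvd q" by simp
    then show ?thesis by blast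
  next
    case False
    then have "euclidean_size (p mod q) < euclidean_size q" by (rule mod_size_less)
    from less[OF this] obtain u v where
      uv: "u * q + v * (p mod q) dvd q" "u * q + v * (p mod q) dvd p mod q" by blast
    have eq: "u * q + v * (p mod q) = v * p + (u - v * (p div q)) * q"
      by (simp add: algebra_simps minus_div_mult_eq_mod[symmetric])
    have "u * q + v * (p mod q) dvd p"
      using uv by (metis dvd_mod_iff dvd_trans dvd_mod_imp_dvd)
    with uv(1) show ?thesis unfolding eq by blast
  qed
qed

lemma coprime_imp_bezout:
  fixes p q :: "'a::euclidean_ring"
  assumes "coprime p q"
  shows "\<exists>u v. u * p + v * q = 1"
proof -
  obtain u v where uv: "u * p + v * q dvd p" "u * p + v * q dvd q"
    using euclidean_bezout by blast
  then have "is_unit (u * p + v * q)"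
    using assms by (meson coprime_common_divisor)
  then obtain k where "1 = (u * p + v * q) * k" by (auto elim: dvdE)
  then have "(k * u) * p + (k * v) * q = 1" by (simp add: algebra_simps)
  then show ?thesis by blast
qed

text \<open>A common divisor of g and g' divides f = g h and, by the product rule, also f'.\<close>

lemma sep_poly_dvd:
  assumes "sep_poly f" "g dvd f"
  shows "sep_poly g"
  unfolding sep_poly_def
proof (rule coprimeI)
  fix d assume d: "d dvd g" "d dvd pderiv g"
  from assms(2) obtain h where h: "f = g * h" by (rule dvdE)
  have "d dvd f" using d(1) assms(2) by (rule dvd_trans)
  moreover have "d dvd pderiv f" unfolding h pderiv_mult using d by simp
  ultimately show "is_unit d" using assms(1) unfolding sep_poly_def by (rule coprime_common_divisor[rotated])
qed

lemma sep_poly_square: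
  fixes z :: "'a::field"
  assumes "(2::'a) \<noteq> 0" "z \<noteq> 0"
  shows "sep_poly [:- z, 0, 1:]"
  unfolding sep_poly_def
proof (rule coprimeI)
  fix d assume "d dvd [:- z, 0, 1:]" "d dvd pderiv [:- z, 0, 1:]"
  \<comment> \<open>The combination (X/2) * 2X - (X^2 - z) is the nonzero constant z. Halving X is
    where the characteristic enters.\<close>
  then have "d dvd [:0, 1/2:] * pderiv [:- z, 0, 1:] - [:- z, 0, 1:]"
    by (intro dvd_diff dvd_mult)
  also have "[:0, 1/2:] * pderiv [:- z, 0, 1:] - [:- z, 0, 1:] = [:z:]"
    using assms by (simp add: pderiv_pCons)
  finally show "is_unit d"
    using assms(2) by (meson dvd_trans is_unit_triv)
qed

text \<open>A second occurrence of the root x would make X - x a common divisor of the polynomial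
  and its derivative. In \<open>galK_fixed_imp_range\<close> this makes a further root of the
  minimal polynomial differ from x.\<close>

lemma sep_poly_linear_factor_root:
  assumes "sep_poly ([:- x, 1:] * p)"
  shows "poly p x \<noteq> 0"
proof
  assume "poly p x = 0"
  then have "[:- x, 1:] dvd p" by (simp add: poly_eq_0_iff_dvd)
  then have "[:- x, 1:] dvd pderiv ([:- x, 1:] * p)"
    unfolding pderiv_mult by (intro dvd_add dvd_triv_left dvd_mult2)
  moreover have "[:- x, 1:] dvd [:- x, 1:] * p" by (rule dvd_triv_left)
  ultimately have "is_unit [:- x, 1:]"
    using assms unfolding sep_poly_def by (meson coprime_common_divisor)
  then show False by (simp add: is_unit_poly_iff)
qed

section \<open>Automorphisms of the separable closure\<close>

text \<open>\<open>R\<close> is the graph of an isomorphism between two rings intermediate between \<open>K\<close> and its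
  separable closure. It is automatically injective and closed under inverses, because the
  inverse of an algebraic element is a polynomial in it.\<close>
definition partial_iso :: "('k::field \<Rightarrow> 'o::field) \<Rightarrow> ('o \<times> 'o) set \<Rightarrow> bool" where
  "partial_iso e R \<longleftrightarrow> (\<forall>k. (e k, e k) \<in> R)
     \<and> (\<forall>x y x' y'. (x, y) \<in> R \<longrightarrow> (x', y') \<in> R \<longrightarrow> (x + x', y + y') \<in> R \<and> (x * x', y * y') \<in> R)
     \<and> (\<forall>y. (0, y) \<in> R \<longrightarrow> y = 0)"

text \<open>For a partial isomorphism \<open>R\<close>, this is the graph of the induced isomorphism
  between polynomial rings over its domain and over its range.\<close>

definition poly_pairs :: "('o::zero \<times> 'o) set \<Rightarrow> ('o poly \<times> 'o poly) set" where
  "poly_pairs R = {(A, B). \<forall>n. (coeff A n, coeff B n) \<in> R}"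

locale sep_closure =
  fixes e :: "'k::field \<Rightarrow> 'o::field"
  assumes sep: "is_sep_closure e"
begin

lemma emb: "field_emb e" using sep unfolding is_sep_closure_def by blast

lemma emb_1 [simp]: "e 1 = 1" and emb_add [simp]: "e (x + y) = e x + e y"
  and emb_mult [simp]: "e (x * y) = e x * e y"
  using emb unfolding field_emb_def by auto

lemma emb_0 [simp]: "e 0 = 0"
  using emb_add[of 0 0] by (metis add.right_neutral add_left_cancel)

lemma emb_minus [simp]: "e (- x) = - e x"
  using emb_add[of x "- x"] by (simp add: eq_neg_iff_add_eq_0 add.commute del: emb_add)

lemma emb_diff [simp]: "e (x - y) = e x - e y"
  using emb_add[of x "- y"] by (simp del: emb_add)

lemma emb_eq_0_iff [simp]: "e x = 0 \<longleftrightarrow> x = 0"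
proof
  assume "e x = 0"
  show "x = 0"
  proof (rule ccontr)
    assume "x \<noteq> 0"
    then have "e (x * inverse x) = 1" by (simp del: emb_mult)
    with \<open>e x = 0\<close> show False by simp
  qed
qed simp

lemma emb_eq_iff [simp]: "e x = e y \<longleftrightarrow> x = y"
  using emb_eq_0_iff[of "x - y"] by simp

lemma emb_inverse [simp]: "e (inverse x) = inverse (e x)"
proof (cases "x = 0")
  case False
  then have "e (x * inverse x) = 1" by (simp del: emb_mult)
  then show ?thesis by (simp add: inverse_unique)
qed simp

lemma emb_divide [simp]: "e (x / y) = e x / e y"
  by (simp add: divide_inverse)

lemma emb_power [simp]: "e (x ^ n) = e x ^ n"
  by (induction n) auto

lemma emb_of_nat [simp]: "e (of_nat n) = of_nat n"
  by (induction n) auto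

lemma emb_numeral [simp]: "e (numeral n) = numeral n"
  using emb_of_nat[of "numeral n"] by simp

lemma emb_sum: "e (sum f S) = (\<Sum>s\<in>S. e (f s))"
  by (induction S rule: infinite_finite_induct) auto

lemma coeff_map_emb [simp]: "coeff (map_poly e p) n = e (coeff p n)"
  by (simp add: coeff_map_poly)

lemma map_emb_pCons [simp]: "map_poly e (pCons c p) = pCons (e c) (map_poly e p)"
  by (rule poly_eqI) (simp add: coeff_pCons split: nat.split)

lemma map_emb_mult: "map_poly e (p * q) = map_poly e p * map_poly e q"
  by (rule poly_eqI) (simp add: coeff_mult emb_sum)

lemma map_emb_add: "map_poly e (p + q) = map_poly e p + map_poly e q"
  by (rule poly_eqI) simp

lemma map_emb_pderiv: "map_poly e (pderiv p) = pderiv (map_poly e p)"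
  by (rule poly_eqI) (simp add: coeff_pderiv)

lemma map_emb_eq_0_iff: "map_poly e p = 0 \<longleftrightarrow> p = 0"
  by (simp add: poly_eq_iff)

text \<open>A field embedding carries over a Bezout identity term by term, and the image identity
  gives coprimality back.\<close>

lemma sep_poly_map_emb:
  assumes "sep_poly p"
  shows "sep_poly (map_poly e p)"
proof -
  obtain u v where "u * p + v * pderiv p = 1"
    using coprime_imp_bezout assms unfolding sep_poly_def by blast
  then have "map_poly e (u * p + v * pderiv p) = 1" by simp
  then have "map_poly e u * map_poly e p + map_poly e v * pderiv (map_poly e p) = 1"
    by (simp add: map_emb_mult map_emb_add map_emb_pderiv)
  then show ?thesis unfolding sep_poly_def by (metis coprimeI dvd_add dvd_mult)
qed

lemma algebraic:
  obtains p where "p \<noteq> 0" "sep_poly p" "poly (map_poly e p) x = 0"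
  using sep unfolding is_sep_closure_def by blast

lemma sep_poly_has_root:
  assumes "degree q > 0" "sep_poly q"
  shows "\<exists>x::'o. poly q x = 0"
  using sep assms unfolding is_sep_closure_def by blast

text \<open>Strip factors X from a polynomial killing a until the constant term c is nonzero. The
  relation then reads a * q(a) = - c, and dividing by - c gives the inverse.\<close>

lemma inverse_as_poly:
  assumes "a \<noteq> 0"
  shows "\<exists>A. a * poly (map_poly e A) a = 1"
proof -
  have "q \<noteq> 0 \<Longrightarrow> poly (map_poly e q) a = 0 \<Longrightarrow> \<exists>A. a * poly (map_poly e A) a = 1" for q
  proof (induction q)
    case (pCons c q)
    show ?case
    proof (cases "c = 0")
      case True
      with pCons assms show ?thesis by auto
    next
      case False
      have eq: "a * poly (map_poly e q) a = - e c"
        using pCons.prems by (simp add: eq_neg_iff_add_eq_0 add.commute)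
      have "map_poly e (smult (- (1 / c)) q) = smult (- (1 / e c)) (map_poly e q)"
        by (rule poly_eqI) simp
      then have "a * poly (map_poly e (smult (- (1 / c)) q)) a = - (1 / e c) * (a * poly (map_poly e q) a)"
        by simp
      also have "\<dots> = 1" unfolding eq using False by simp
      finally show ?thesis by blast
    qed
  qed simp
  then show ?thesis by (rule algebraic) blast+
qed

section \<open>Partial isomorphisms and their extension to one more element\<close>

context
  fixes R
  assumes R: "partial_iso e R"
begin

lemma pair_emb: "(e k, e k) \<in> R"
  and pair_add: "(x, y) \<in> R \<Longrightarrow> (x', y') \<in> R \<Longrightarrow> (x + x', y + y') \<in> R"
  and pair_mult: "(x, y) \<in> R \<Longrightarrow> (x', y') \<in> R \<Longrightarrow> (x * x', y * y') \<in> R"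
  and pair_0: "(0, y) \<in> R \<Longrightarrow> y = 0"
  using R unfolding partial_iso_def by blast+

lemma pair_0_0: "(0, 0) \<in> R"
  using pair_emb[of 0] by simp

lemma pair_diff: "(x, y) \<in> R \<Longrightarrow> (x', y') \<in> R \<Longrightarrow> (x - x', y - y') \<in> R"
  using pair_add[of x y "e (-1) * x'" "e (-1) * y'"] pair_mult[of "e (-1)" "e (-1)" x' y'] pair_emb[of "-1"]
  by simp

lemma pair_sum: "(\<And>i. i \<in> S \<Longrightarrow> (f i, h i) \<in> R) \<Longrightarrow> (sum f S, sum h S) \<in> R"
  by (induction S rule: infinite_finite_induct) (auto simp: pair_0_0 pair_add)

lemma pair_fun: "(x, y) \<in> R \<Longrightarrow> (x, y') \<in> R \<Longrightarrow> y = y'"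
  using pair_diff[of x y x y'] pair_0[of "y - y'"] by simp

lemma pair_poly: "(a, b) \<in> R \<Longrightarrow> (poly (map_poly e A) a, poly (map_poly e A) b) \<in> R"
  by (induction A) (auto simp: pair_0_0 pair_add pair_mult pair_emb)

text \<open>Since A has coefficients in K, the relation a * A(a) = 1 is carried to b * A(b) = 1. In
  particular \<open>R\<close> has trivial kernel also when read backwards, which is what the
  converse relation requires.\<close>

lemma pair_inverse:
  assumes ab: "(a, b) \<in> R" and "a \<noteq> 0"
  shows "b \<noteq> 0" "(inverse a, inverse b) \<in> R"
proof -
  obtain A where A: "a * poly (map_poly e A) a = 1" using inverse_as_poly assms by blast
  have p: "(poly (map_poly e A) a, poly (map_poly e A) b) \<in> R" using ab by (rule pair_poly)
  have "(1, b * poly (map_poly e A) b) \<in> R" using pair_mult[OF ab p] A by simp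
  then have B: "b * poly (map_poly e A) b = 1" using pair_fun pair_emb[of 1] by fastforce
  then show "b \<noteq> 0" by auto
  show "(inverse a, inverse b) \<in> R" using p A B by (simp add: inverse_unique)
qed

lemma partial_iso_converse: "partial_iso e (R\<inverse>)"
  unfolding partial_iso_def using pair_emb pair_add pair_mult pair_inverse(1) by fastforce

lemma poly_pairs_mult: "(A, B) \<in> poly_pairs R \<Longrightarrow> (A', B') \<in> poly_pairs R \<Longrightarrow> (A * A', B * B') \<in> poly_pairs R"
  unfolding poly_pairs_def by (auto simp: coeff_mult intro!: pair_sum pair_mult)

lemma poly_pairs_add: "(A, B) \<in> poly_pairs R \<Longrightarrow> (A', B') \<in> poly_pairs R \<Longrightarrow> (A + A', B + B') \<in> poly_pairs R"
  unfolding poly_pairs_def by (auto intro!: pair_add)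

lemma poly_pairs_diff: "(A, B) \<in> poly_pairs R \<Longrightarrow> (A', B') \<in> poly_pairs R \<Longrightarrow> (A - A', B - B') \<in> poly_pairs R"
  unfolding poly_pairs_def by (auto intro!: pair_diff)

lemma poly_pairs_monom: "(a, b) \<in> R \<Longrightarrow> (monom a n, monom b n) \<in> poly_pairs R"
  unfolding poly_pairs_def by (auto simp: pair_0_0)

lemma poly_pairs_map_emb: "(map_poly e q, map_poly e q) \<in> poly_pairs R"
  unfolding poly_pairs_def by (auto simp: pair_emb)

lemma poly_pairs_0: "(0, B) \<in> poly_pairs R \<Longrightarrow> B = 0"
  unfolding poly_pairs_def by (auto intro!: poly_eqI pair_0)

text \<open>Long division carried out in both components at once. The quotient must keep its
  coefficients in the domain of \<open>R\<close>; this works because \<open>pair_inverse\<close>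
  inverts the leading coefficient of P there.\<close>

lemma poly_pairs_division:
  assumes PQ: "(P, Q) \<in> poly_pairs R" and "P \<noteq> 0"
  shows "(A, B) \<in> poly_pairs R \<Longrightarrow>
    \<exists>S T. (S, T) \<in> poly_pairs R \<and> (A - P * S = 0 \<or> degree (A - P * S) < degree P)"
proof (induction "degree A" arbitrary: A B rule: less_induct)
  case less
  have zero: "(0, 0) \<in> poly_pairs R" unfolding poly_pairs_def by (simp add: pair_0_0)
  show ?case
  proof (cases "A = 0 \<or> degree A < degree P")
    case True
    then show ?thesis using zero by force
  next
    case False
    define n where "n = degree A - degree P"
    define a where "a = lead_coeff A * inverse (lead_coeff P)"
    \<comment> \<open>The partner of a leading coefficient is read off at the same degree, so that
      no comparison of the degrees in the two components enters.\<close>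
    define b where "b = coeff B (degree A) * inverse (coeff Q (degree P))"
    have PR: "(lead_coeff P, coeff Q (degree P)) \<in> R" and AR: "(lead_coeff A, coeff B (degree A)) \<in> R"
      using PQ less.prems unfolding poly_pairs_def by auto
    have "(inverse (lead_coeff P), inverse (coeff Q (degree P))) \<in> R"
      using pair_inverse(2)[OF PR] \<open>P \<noteq> 0\<close> by simp
    with AR have "(a, b) \<in> R"
      unfolding a_def b_def by (rule pair_mult)
    then have mn: "(monom a n, monom b n) \<in> poly_pairs R" by (rule poly_pairs_monom)
    define A' where "A' = A - P * monom a n"
    have A': "(A', B - Q * monom b n) \<in> poly_pairs R"
      unfolding A'_def by (intro poly_pairs_diff poly_pairs_mult less.prems PQ mn)
    have a0: "a \<noteq> 0" using False \<open>P \<noteq> 0\<close> by (simp add: a_def)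
    have deg: "degree (P * monom a n) = degree A"
      using False \<open>P \<noteq> 0\<close> a0 by (simp add: degree_mult_eq degree_monom_eq n_def)
    have "lead_coeff (P * monom a n) = lead_coeff A"
      using \<open>P \<noteq> 0\<close> by (simp only: lead_coeff_mult lead_coeff_monom) (simp add: a_def)
    then have "coeff A' (degree A) = 0" unfolding A'_def using deg by simp
    moreover have "degree A' \<le> degree A" unfolding A'_def using deg by (intro degree_diff_le) auto
    ultimately have "A' = 0 \<or> degree A' < degree A"
      by (metis eq_zero_or_degree_less)
    then consider "A' = 0" | "degree A' < degree A" by blast
    then show ?thesis
    proof cases
      case 1
      then show ?thesis using mn unfolding A'_def by blast
    next
      case 2
      from less.hyps[OF this A'] obtain S T where ST: "(S, T) \<in> poly_pairs R"
        "A' - P * S = 0 \<or> degree (A' - P * S) < degree P" by blast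
      have "(monom a n + S, monom b n + T) \<in> poly_pairs R" using mn ST(1) by (rule poly_pairs_add)
      moreover have "A - P * (monom a n + S) = A' - P * S" by (simp add: A'_def algebra_simps)
      ultimately show ?thesis using ST(2) by metis
    qed
  qed
qed

text \<open>The new graph sends A(x) to B(y). This is well defined as soon as every relation
  satisfied by x goes over to one satisfied by y.\<close>

lemma partial_iso_adjoin:
  assumes "\<And>A B. (A, B) \<in> poly_pairs R \<Longrightarrow> poly A x = 0 \<Longrightarrow> poly B y = 0"
  shows "\<exists>R'. partial_iso e R' \<and> R \<subseteq> R' \<and> (x, y) \<in> R'"
proof (intro exI conjI)
  let ?R' = "{(poly A x, poly B y) | A B. (A, B) \<in> poly_pairs R}"
  have const: "([:a:], [:b:]) \<in> poly_pairs R" if "(a, b) \<in> R" for a b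
    using poly_pairs_monom[OF that, of 0] by (simp add: monom_0)
  show sub: "R \<subseteq> ?R'"
  proof clarify
    fix a b assume "(a, b) \<in> R"
    from const[OF this] show "\<exists>A B. (a, b) = (poly A x, poly B y) \<and> (A, B) \<in> poly_pairs R"
      by (intro exI[of _ "[:a:]"] exI[of _ "[:b:]"]) simp
  qed
  have "(monom 1 1, monom 1 1) \<in> poly_pairs R" using poly_pairs_monom pair_emb[of 1] by simp
  then show "(x, y) \<in> ?R'"
    by (intro CollectI exI[of _ "monom 1 1"] conjI) (auto simp: poly_monom)
  show "partial_iso e ?R'"
    unfolding partial_iso_def
  proof (intro conjI allI impI)
    show "(e k, e k) \<in> ?R'" for k using pair_emb sub by blast
    fix a b a' b' assume "(a, b) \<in> ?R'" "(a', b') \<in> ?R'"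
    then obtain A B A' B' where AB: "(A, B) \<in> poly_pairs R" "(A', B') \<in> poly_pairs R"
      and ab: "a = poly A x" "b = poly B y" "a' = poly A' x" "b' = poly B' y" by blast
    show "(a + a', b + b') \<in> ?R'" "(a * a', b * b') \<in> ?R'"
      using poly_pairs_add[OF AB] poly_pairs_mult[OF AB] unfolding ab poly_add[symmetric] poly_mult[symmetric]
      by blast+
  next
    fix b assume "(0, b) \<in> ?R'"
    then show "b = 0" using assms by force
  qed
qed

text \<open>\<open>P\<close> plays the role of the minimal polynomial of \<open>x\<close> over the domain of the partial
  isomorphism \<open>R\<close>, and \<open>Q\<close> that of its image under \<open>R\<close>.\<close>
lemma minimal_poly_pair:
  obtains P Q where "(P, Q) \<in> poly_pairs R" "poly P x = 0" "degree Q > 0" "sep_poly Q"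
    "\<And>y. poly Q y = 0 \<Longrightarrow> \<exists>R'. partial_iso e R' \<and> R \<subseteq> R' \<and> (x, y) \<in> R'"
proof -
  let ?V = "\<lambda>(P, Q). (P, Q) \<in> poly_pairs R \<and> P \<noteq> 0 \<and> poly P x = 0"
  obtain q where q: "q \<noteq> 0" "sep_poly q" "poly (map_poly e q) x = 0" by (rule algebraic)
  have "?V (map_poly e q, map_poly e q)"
    using q poly_pairs_map_emb by (simp add: map_emb_eq_0_iff)
  from ex_has_least_nat[of ?V, OF this, of "\<lambda>(P, Q). degree P"]
  obtain P Q where PQ: "(P, Q) \<in> poly_pairs R" "P \<noteq> 0" "poly P x = 0"
    and min: "\<And>P' Q'. (P', Q') \<in> poly_pairs R \<Longrightarrow> P' \<noteq> 0 \<Longrightarrow> poly P' x = 0 \<Longrightarrow> degree P \<le> degree P'"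
    by fast
  \<comment> \<open>The remainder of A modulo P vanishes at x, so it is zero by minimality of the
    degree. Its partner is then zero as well, and this says that Q divides B.\<close>
  have dvd: "Q dvd B" if AB: "(A, B) \<in> poly_pairs R" "poly A x = 0" for A B
  proof -
    obtain S T where ST: "(S, T) \<in> poly_pairs R" "A - P * S = 0 \<or> degree (A - P * S) < degree P"
      using poly_pairs_division[OF PQ(1,2) AB(1)] by blast
    have pp: "(A - P * S, B - Q * T) \<in> poly_pairs R"
      by (intro poly_pairs_diff poly_pairs_mult AB PQ ST)
    have "poly (A - P * S) x = 0" using AB PQ by simp
    then have "A - P * S = 0" using min[OF pp] ST(2) by (meson not_le)
    then have "B - Q * T = 0" using pp poly_pairs_0 by metis
    then show ?thesis by simp
  qed
  \<comment> \<open>Nonvanishing of coefficients passes from P to Q, so a constant Q would force P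
    to be a nonzero constant with root x.\<close>
  have "degree Q > 0"
  proof (rule ccontr)
    assume "\<not> degree Q > 0"
    then have "coeff Q n = 0" if "n > 0" for n using that by (simp add: coeff_eq_0)
    then have "coeff P n = 0" if "n > 0" for n
      using that PQ(1) pair_inverse(1) unfolding poly_pairs_def by blast
    then have "degree P = 0" using leading_coeff_0_iff PQ(2) by blast
    then obtain c where "P = [:c:]" by (rule degree_eq_zeroE)
    with PQ show False by auto
  qed
  moreover have "sep_poly Q"
    using sep_poly_dvd[OF sep_poly_map_emb[OF q(2)]] dvd[OF poly_pairs_map_emb q(3)] .
  moreover have "\<exists>R'. partial_iso e R' \<and> R \<subseteq> R' \<and> (x, y) \<in> R'" if "poly Q y = 0" for y
    by (rule partial_iso_adjoin) (use dvd that in \<open>metis dvd_def mult_zero_left poly_mult\<close>)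
  ultimately show ?thesis using that PQ by blast
qed

lemma partial_iso_extend: "\<exists>R'. partial_iso e R' \<and> R \<subseteq> R' \<and> x \<in> Domain R'"
  by (rule minimal_poly_pair[of x]) (meson Domain.DomainI sep_poly_has_root)

end

section \<open>Automorphisms of the whole separable closure and their fixed field\<close>

lemma partial_iso_Union_chain:
  assumes "subset.chain {R'. partial_iso e R'} C" "C \<noteq> {}"
  shows "partial_iso e (\<Union>C)"
proof -
  have C: "partial_iso e X" if "X \<in> C" for X using that assms unfolding subset.chain_def by auto
  have dir: "\<exists>X\<in>C. p \<in> X \<and> q \<in> X" if "p \<in> \<Union>C" "q \<in> \<Union>C" for p q
    using that assms(1) unfolding subset.chain_def by blast
  show ?thesis
    unfolding partial_iso_def
  proof (intro conjI allI impI)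
    show "(e k, e k) \<in> \<Union>C" for k using assms(2) C pair_emb by blast
    fix x y x' y' assume "(x, y) \<in> \<Union>C" "(x', y') \<in> \<Union>C"
    from dir[OF this] show "(x + x', y + y') \<in> \<Union>C" "(x * x', y * y') \<in> \<Union>C"
      using C pair_add pair_mult by blast+
  next
    show "(0, y) \<in> \<Union>C \<Longrightarrow> y = 0" for y using C pair_0 by blast
  qed
qed

text \<open>Zorn's lemma gives a maximal partial isomorphism above \<open>R\<close>. By
  \<open>partial_iso_extend\<close> its domain is everything, and the same lemma applied to its
  converse shows that its range is everything.\<close>

lemma partial_iso_automorphism:
  assumes "partial_iso e R" "(x, y) \<in> R"
  shows "\<exists>g\<in>galK e. g x = y"
proof -
  let ?A = "{R'. partial_iso e R' \<and> R \<subseteq> R'}"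
  have "\<exists>M\<in>?A. \<forall>X\<in>?A. M \<subseteq> X \<longrightarrow> X = M"
  proof (rule subset_Zorn_nonempty)
    show "?A \<noteq> {}" using assms(1) by blast
    fix C assume C: "C \<noteq> {}" "subset.chain ?A C"
    then have "subset.chain {R'. partial_iso e R'} C" unfolding subset.chain_def by blast
    moreover have "R \<subseteq> \<Union>C" using C unfolding subset.chain_def by blast
    ultimately show "\<Union>C \<in> ?A" using C(1) partial_iso_Union_chain by blast
  qed
  then obtain M where "M \<in> ?A" and max': "\<forall>X\<in>?A. M \<subseteq> X \<longrightarrow> X = M" ..
  then have M: "partial_iso e M" "R \<subseteq> M" by simp_all
  have max: "X = M" if "partial_iso e X" "M \<subseteq> X" for X
  proof -
    have "R \<subseteq> X" using M(2) that(2) by (rule subset_trans)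
    then have "X \<in> ?A" using that(1) by simp
    from bspec[OF max' this] that(2) show ?thesis by (rule mp)
  qed
  have dom: "a \<in> Domain M" for a
    using partial_iso_extend[OF M(1), of a] max by blast
  have ran: "b \<in> Range M" for b
  proof -
    obtain R' where R': "partial_iso e R'" "M\<inverse> \<subseteq> R'" "b \<in> Domain R'"
      using partial_iso_extend[OF partial_iso_converse[OF M(1)], of b] by blast
    then have "R'\<inverse> = M" by (intro max partial_iso_converse) auto
    then show ?thesis using R'(3) by blast
  qed
  define g where "g a = (SOME b. (a, b) \<in> M)" for a
  have gM: "(a, g a) \<in> M" for a unfolding g_def using dom[of a] by (auto intro: someI)
  have g_eq: "g a = b" if "(a, b) \<in> M" for a b using pair_fun[OF M(1) gM that] .
  have "bij g"
  proof (rule bijI)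
    show "inj g"
    proof (rule injI)
      fix a a' assume "g a = g a'"
      then show "a = a'"
        using pair_fun[OF partial_iso_converse[OF M(1)], of "g a" a a'] gM[of a] gM[of a'] by simp
    qed
    show "surj g" unfolding surj_def using ran g_eq by (metis RangeE)
  qed
  then have "g \<in> galK e"
    unfolding galK_def using g_eq gM pair_add[OF M(1)] pair_mult[OF M(1)] pair_emb[OF M(1)] by simp
  moreover have "g x = y" using g_eq assms(2) M(2) by blast
  ultimately show ?thesis by blast
qed

text \<open>Start from the identity of K. If x is not in K, its minimal polynomial has degree at
  least 2 and, being separable, a root y other than x; sending x to y extends to an automorphism
  that moves x.\<close>

theorem galK_fixed_imp_range:
  assumes "\<And>g. g \<in> galK e \<Longrightarrow> g x = x"
  shows "x \<in> range e"
proof (rule ccontr)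
  assume x: "x \<notin> range e"
  let ?R = "{(e k, e k) | k. True}"
  have R: "partial_iso e ?R"
    unfolding partial_iso_def
    by (auto, metis emb_add, metis emb_mult)
  obtain P Q where PQ: "(P, Q) \<in> poly_pairs ?R" "poly P x = 0" "degree Q > 0" "sep_poly Q"
    "\<And>y. poly Q y = 0 \<Longrightarrow> \<exists>R'. partial_iso e R' \<and> ?R \<subseteq> R' \<and> (x, y) \<in> R'"
    by (rule minimal_poly_pair[OF R, of x]) blast
  have "P = Q" using PQ(1) unfolding poly_pairs_def by (auto simp: poly_eq_iff) metis
  then obtain P1 where P1: "Q = [:- x, 1:] * P1" using PQ(2) by (auto simp: poly_eq_0_iff_dvd elim: dvdE)
  have coeffs: "coeff Q n \<in> range e" for n using PQ(1) unfolding poly_pairs_def by auto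
  \<comment> \<open>If the cofactor were a constant c, the coefficients - x c and c of Q would lie
    in K, and x would be minus their quotient.\<close>
  have "degree P1 > 0"
  proof (rule ccontr)
    assume "\<not> degree P1 > 0"
    then obtain c where c: "P1 = [:c:]" by (meson degree_eq_zeroE gr0I)
    then have "c \<noteq> 0" using P1 PQ(3) by auto
    have "- x * c \<in> range e" "c \<in> range e"
      using coeffs[of 0] coeffs[of 1] unfolding P1 c by (simp_all add: mult.commute)
    then obtain k l where "e k = - x * c" "e l = c" by force
    then have "x = e (- k / l)" using \<open>c \<noteq> 0\<close> by simp
    then show False using x by blast
  qed
  moreover have "sep_poly P1" using PQ(4) P1 by (metis sep_poly_dvd dvd_triv_right)
  ultimately obtain y where y: "poly P1 y = 0" using sep_poly_has_root by blast
  have "y \<noteq> x" using sep_poly_linear_factor_root[of x P1] PQ(4) P1 y by auto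
  have "poly Q y = 0" using y P1 by simp
  then obtain g where "g \<in> galK e" "g x = y" using PQ(5) partial_iso_automorphism by blast
  with assms \<open>y \<noteq> x\<close> show False by blast
qed

end

section \<open>Hilbert's Theorem 90\<close>

text \<open>Evaluating the relation at y x and subtracting \<open>\<psi> y\<close> times the
  relation at x removes the term of \<open>\<psi>\<close>. Everything is confined to a submonoid
  \<open>E\<close>, because in \<open>hilbert90\<close> the values of the automorphisms are
  controlled only on a subfield.\<close>

lemma dedekind_independence:
  fixes C :: "('a::monoid_mult \<Rightarrow> 'b::field) set" and a :: "('a \<Rightarrow> 'b) \<Rightarrow> 'b"
  assumes "finite C" and "1 \<in> E" and E: "\<And>x y. x \<in> E \<Longrightarrow> y \<in> E \<Longrightarrow> x * y \<in> E"
    and "\<And>\<chi>. \<chi> \<in> C \<Longrightarrow> \<chi> 1 = 1"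
    and "\<And>\<chi> x y. \<chi> \<in> C \<Longrightarrow> x \<in> E \<Longrightarrow> y \<in> E \<Longrightarrow> \<chi> (x * y) = \<chi> x * \<chi> y"
    and "\<And>\<chi> \<psi>. \<chi> \<in> C \<Longrightarrow> \<psi> \<in> C \<Longrightarrow> \<chi> \<noteq> \<psi> \<Longrightarrow> \<exists>x\<in>E. \<chi> x \<noteq> \<psi> x"
    and "\<And>x. x \<in> E \<Longrightarrow> (\<Sum>\<chi>\<in>C. a \<chi> * \<chi> x) = 0"
  shows "\<forall>\<chi>\<in>C. a \<chi> = 0"
  using assms(1,4-)
proof (induction C arbitrary: a rule: finite_induct)
  case (insert \<psi> C)
  have "a \<chi> = 0" if \<chi>: "\<chi> \<in> C" for \<chi>
  proof -
    obtain y where y: "y \<in> E" "\<chi> y \<noteq> \<psi> y" using insert \<chi> by (metis insertCI)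
    have "\<forall>\<chi>\<in>C. a \<chi> * (\<chi> y - \<psi> y) = 0"
    proof (rule insert.IH)
      fix x assume x: "x \<in> E"
      have "(\<Sum>\<chi>\<in>C. a \<chi> * (\<chi> y - \<psi> y) * \<chi> x)
          = (\<Sum>\<chi>\<in>insert \<psi> C. a \<chi> * (\<chi> y - \<psi> y) * \<chi> x)"
        using insert.hyps by simp
      also have "\<dots> = (\<Sum>\<chi>\<in>insert \<psi> C. a \<chi> * \<chi> (y * x) - \<psi> y * (a \<chi> * \<chi> x))"
        by (rule sum.cong) (simp_all add: insert.prems x y(1) algebra_simps)
      also have "\<dots> = (\<Sum>\<chi>\<in>insert \<psi> C. a \<chi> * \<chi> (y * x)) - \<psi> y * (\<Sum>\<chi>\<in>insert \<psi> C. a \<chi> * \<chi> x)"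
        by (simp only: sum_subtractf sum_distrib_left)
      also have "\<dots> = 0" using insert.prems(4)[OF E[OF y(1) x]] insert.prems(4)[OF x] by simp
      finally show "(\<Sum>\<chi>\<in>C. a \<chi> * (\<chi> y - \<psi> y) * \<chi> x) = 0" .
    qed (use insert.prems in auto)
    with \<chi> y show ?thesis by auto
  qed
  moreover from this have "a \<psi> = 0"
    using insert.prems(4)[OF \<open>1 \<in> E\<close>] insert.prems(1)[of \<psi>] insert.hyps by simp
  ultimately show ?case by simp
qed simp

context sep_closure
begin

lemma galK_add: "g \<in> galK e \<Longrightarrow> g (x + y) = g x + g y"
  and galK_mult: "g \<in> galK e \<Longrightarrow> g (x * y) = g x * g y"
  and galK_emb: "g \<in> galK e \<Longrightarrow> g (e k) = e k"
  and galK_bij: "g \<in> galK e \<Longrightarrow> bij g"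
  unfolding galK_def by auto

lemma galK_0: "g \<in> galK e \<Longrightarrow> g 0 = 0"
  and galK_1: "g \<in> galK e \<Longrightarrow> g 1 = 1"
  using galK_emb[of g 0] galK_emb[of g 1] by simp_all

lemma galK_minus: "g \<in> galK e \<Longrightarrow> g (- x) = - g x"
  using galK_add[of g x "- x"] galK_0[of g] by (simp add: eq_neg_iff_add_eq_0 add.commute)

lemma galK_diff: "g \<in> galK e \<Longrightarrow> g (x - y) = g x - g y"
  using galK_add[of g x "- y"] galK_minus[of g y] by simp

lemma galK_eq_0_iff: "g \<in> galK e \<Longrightarrow> g x = 0 \<longleftrightarrow> x = 0"
  using galK_bij galK_0 by (metis bij_is_inj injD)

lemma galK_inverse: "g \<in> galK e \<Longrightarrow> g (inverse x) = inverse (g x)"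
  using galK_mult[of g x "inverse x"] galK_1[of g] galK_0[of g]
  by (cases "x = 0") (auto intro: inverse_unique[symmetric])

lemma galK_divide: "g \<in> galK e \<Longrightarrow> g (x / y) = g x / g y"
  by (simp add: divide_inverse galK_mult galK_inverse)

lemma galK_power: "g \<in> galK e \<Longrightarrow> g (x ^ n) = g x ^ n"
  by (induction n) (auto simp: galK_1 galK_mult)

lemma galK_sum: "g \<in> galK e \<Longrightarrow> g (sum f S) = (\<Sum>s\<in>S. g (f s))"
  by (induction S rule: infinite_finite_induct) (auto simp: galK_0 galK_add)

lemmas galK_hom = galK_add galK_mult galK_emb galK_0 galK_1 galK_minus galK_diff galK_eq_0_iff
  galK_inverse galK_divide galK_power galK_sum

lemma galK_comp: "g \<in> galK e \<Longrightarrow> h \<in> galK e \<Longrightarrow> g \<circ> h \<in> galK e"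
  unfolding galK_def by (auto intro: bij_comp)

lemma galK_inv:
  assumes g: "g \<in> galK e"
  shows "inv_into UNIV g \<in> galK e"
proof -
  have inv: "g (inv_into UNIV g x) = x" "inv_into UNIV g (g x) = x" for x
    using galK_bij[OF g] by (simp_all add: bij_is_surj surj_f_inv_f bij_is_inj)
  show ?thesis
    unfolding galK_def using bij_imp_bij_inv[OF galK_bij[OF g]]
    by (auto, metis inv galK_add[OF g], metis inv galK_mult[OF g], metis inv galK_emb[OF g])
qed

lemma galK_comp_inv: "g \<in> galK e \<Longrightarrow> g \<circ> inv_into UNIV g = id" "g \<in> galK e \<Longrightarrow> inv_into UNIV g \<circ> g = id"
  using galK_bij by (simp_all add: surj_iff[symmetric] inj_iff[symmetric] bij_is_surj bij_is_inj)

lemma galK_id: "id \<in> galK e"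
  unfolding galK_def by auto

lemma galK_poly: "g \<in> galK e \<Longrightarrow> g (poly (map_poly e p) x) = poly (map_poly e p) (g x)"
  by (induction p) (simp_all add: galK_hom)

text \<open>Automorphisms over K permute the roots of a polynomial over K, so adding to each element
  of S all roots of a polynomial that kills it gives a stable set.\<close>

lemma finite_stable_superset:
  assumes "finite S"
  obtains F where "finite F" "S \<subseteq> F" "\<And>g x. g \<in> galK e \<Longrightarrow> x \<in> F \<Longrightarrow> g x \<in> F"
proof -
  have "\<forall>x. \<exists>p. p \<noteq> 0 \<and> poly (map_poly e p) x = 0" by (meson algebraic)
  then obtain P where P: "P x \<noteq> 0" "poly (map_poly e (P x)) x = 0" for x by metis
  let ?F = "\<Union>x\<in>S. {y. poly (map_poly e (P x)) y = 0}"
  have "finite ?F" using assms P(1) by (intro finite_UN_I poly_roots_finite) (simp_all add: map_emb_eq_0_iff)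
  moreover have "S \<subseteq> ?F" using P(2) by blast
  moreover have "g x \<in> ?F" if "g \<in> galK e" "x \<in> ?F" for g x
    using that galK_poly[OF that(1)] galK_0[OF that(1)] by (smt (verit) UN_iff mem_Collect_eq)
  ultimately show ?thesis using that by blast
qed

text \<open>By continuity the problem descends to the finite group of restrictions of H to a finite
  stable set \<open>F\<close>. The solution is the classical sum of (f h)^(-1) h(t) over
  representatives h, for a t where it does not vanish.\<close>

theorem hilbert90:
  assumes H: "H \<subseteq> galK e" "id \<in> H" "\<And>g h. g \<in> H \<Longrightarrow> h \<in> H \<Longrightarrow> g \<circ> h \<in> H" "\<And>g. g \<in> H \<Longrightarrow> inv_into UNIV g \<in> H"
    and f0: "\<And>g. g \<in> H \<Longrightarrow> f g \<noteq> 0"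
    and fmult: "\<And>g h. g \<in> H \<Longrightarrow> h \<in> H \<Longrightarrow> f (g \<circ> h) = f g * g (f h)"
    and S: "finite S" "\<And>g. g \<in> H \<Longrightarrow> (\<And>s. s \<in> S \<Longrightarrow> g s = s) \<Longrightarrow> f g = 1"
  shows "\<exists>w. w \<noteq> 0 \<and> (\<forall>g\<in>H. g w = f g * w)"
proof -
  obtain F where F: "finite F" "S \<subseteq> F" "\<And>g x. g \<in> galK e \<Longrightarrow> x \<in> F \<Longrightarrow> g x \<in> F"
    using finite_stable_superset[OF S(1)] by blast
  define \<rho> where "\<rho> g = restrict g F" for g :: "'o \<Rightarrow> 'o"
  have \<rho>_eq: "\<rho> g = \<rho> h \<longleftrightarrow> (\<forall>x\<in>F. g x = h x)" for g h
    unfolding \<rho>_def by (metis restrict_apply' restrict_ext)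
  have "\<rho> ` H \<subseteq> F \<rightarrow>\<^sub>E F" unfolding \<rho>_def using F(3) H(1) by auto
  then have fin: "finite (\<rho> ` H)" using F(1) by (meson finite_PiE finite_subset)
  define rep where "rep g = inv_into H \<rho> (\<rho> g)" for g
  have rep: "rep g \<in> H" "\<rho> (rep g) = \<rho> g" if "g \<in> H" for g
    unfolding rep_def using that by (simp_all add: inv_into_into f_inv_into_f)
  have rep_cong: "rep g = rep h" if "\<rho> g = \<rho> h" for g h unfolding rep_def using that by simp
  define C where "C = rep ` H"
  have CH: "C \<subseteq> H" unfolding C_def using rep by blast
  have "C = inv_into H \<rho> ` (\<rho> ` H)" unfolding C_def rep_def by auto
  then have finC: "finite C" using fin by simp
  have injC: "g = h" if "g \<in> C" "h \<in> C" "\<rho> g = \<rho> h" for g h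
    using that rep(2) rep_cong unfolding C_def by (metis imageE)
  \<comment> \<open>\<open>E\<close> is the fixed field of the subgroup of H acting trivially on
    \<open>F\<close>. For t in \<open>E\<close>, both g t and f g depend only on the restriction of
    g to \<open>F\<close>.\<close>
  define E where "E = {t. \<forall>u\<in>H. (\<forall>x\<in>F. u x = x) \<longrightarrow> u t = t}"
  have agree: "g t = h t \<and> f g = f h" if "g \<in> H" "h \<in> H" "\<rho> g = \<rho> h" "t \<in> E" for g h t
  proof -
    define u where "u = inv_into UNIV g \<circ> h"
    have gG: "g \<in> galK e" using that H by blast
    have uH: "u \<in> H" unfolding u_def using that H by blast
    have h: "h = g \<circ> u" unfolding u_def using galK_comp_inv(1)[OF gG] by (simp add: o_assoc)
    have uF: "u x = x" if "x \<in> F" for x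
      using that \<open>\<rho> g = \<rho> h\<close> galK_comp_inv(2)[OF gG] unfolding \<rho>_eq u_def by (metis comp_apply id_apply)
    have "f u = 1" using S(2)[OF uH] uF F(2) by blast
    then have "f h = f g" unfolding h using fmult[OF that(1) uH] galK_1[OF gG] by simp
    moreover have "u t = t" using that(4) uH uF unfolding E_def by blast
    ultimately show ?thesis unfolding h by simp
  qed
  have HG: "g \<in> galK e" if "g \<in> H" for g using that H by blast
  have E1: "1 \<in> E" unfolding E_def using HG galK_1 by simp
  have Emult: "x * y \<in> E" if "x \<in> E" "y \<in> E" for x y
    unfolding E_def
  proof (intro CollectI ballI impI)
    fix u assume u: "u \<in> H" "\<forall>x\<in>F. u x = x"
    then have "u x = x" "u y = y" using that unfolding E_def by blast+
    then show "u (x * y) = x * y" using galK_mult[OF HG[OF u(1)]] by simp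
  qed
  \<comment> \<open>If the sum vanished for all t in \<open>E\<close>, independence of characters
    would make the coefficients zero, but they are inverses of nonzero elements.\<close>
  have "\<exists>t\<in>E. (\<Sum>h\<in>C. inverse (f h) * h t) \<noteq> 0"
  proof (rule ccontr)
    assume "\<not> ?thesis"
    then have zero: "(\<Sum>h\<in>C. inverse (f h) * h t) = 0" if "t \<in> E" for t using that by blast
    have "\<forall>h\<in>C. inverse (f h) = 0"
    proof (rule dedekind_independence[where E = E])
      fix h k assume hk: "h \<in> C" "k \<in> C" "h \<noteq> k"
      then obtain x where "x \<in> F" "h x \<noteq> k x" using injC \<rho>_eq by metis
      moreover have "F \<subseteq> E" unfolding E_def by blast
      ultimately show "\<exists>x\<in>E. h x \<noteq> k x" by blast
    qed (use finC zero CH HG galK_1 galK_mult E1 Emult in auto)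
    moreover have "rep id \<in> C" unfolding C_def using H(2) by (rule imageI)
    ultimately have "inverse (f (rep id)) = 0" by (rule bspec)
    then show False using f0[OF rep(1)[OF H(2)]] by simp
  qed
  then obtain t where t: "t \<in> E" "(\<Sum>h\<in>C. inverse (f h) * h t) \<noteq> 0" by blast
  define \<phi> where "\<phi> h = inverse (f h) * h t" for h
  have \<phi>_rep: "\<phi> (rep h) = \<phi> h" if "h \<in> H" for h
    using agree[OF rep(1)[OF that] that rep(2)[OF that] t(1)] unfolding \<phi>_def by simp
  have "g (sum \<phi> C) = f g * sum \<phi> C" if g: "g \<in> H" for g
  proof -
    have inj: "inj_on (\<lambda>h. rep (g \<circ> h)) C"
    proof (rule inj_onI)
      fix h k assume hk: "h \<in> C" "k \<in> C" "rep (g \<circ> h) = rep (g \<circ> k)"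
      then have "\<rho> (g \<circ> h) = \<rho> (g \<circ> k)" using rep(2) CH H(3)[OF g] by (metis subsetD)
      then have "\<rho> h = \<rho> k" unfolding \<rho>_eq using galK_bij[OF HG[OF g]] by (simp add: bij_is_inj inj_eq)
      with hk injC show "h = k" by blast
    qed
    \<comment> \<open>Left translation by g permutes the classes of automorphisms agreeing on
      \<open>F\<close>, and \<open>rep\<close> brings the translates back into
      \<open>C\<close>.\<close>
    have img: "(\<lambda>h. rep (g \<circ> h)) ` C = C"
      using inj finC CH H(3)[OF g] by (intro endo_inj_surj) (auto simp: C_def)
    have "g (sum \<phi> C) = (\<Sum>h\<in>C. g (\<phi> h))" using galK_sum HG g by blast
    also have "\<dots> = (\<Sum>h\<in>C. f g * \<phi> (g \<circ> h))"
    proof (rule sum.cong)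
      fix h assume "h \<in> C"
      then have "h \<in> H" using CH by blast
      then show "g (\<phi> h) = f g * \<phi> (g \<circ> h)"
        unfolding \<phi>_def using fmult[OF g \<open>h \<in> H\<close>] f0[OF g] HG[OF g] by (simp add: galK_hom field_simps)
    qed simp
    also have "\<dots> = (\<Sum>h\<in>C. f g * \<phi> (rep (g \<circ> h)))"
      using CH H(3)[OF g] by (intro sum.cong) (auto simp: \<phi>_rep)
    also have "\<dots> = f g * (\<Sum>h\<in>C. \<phi> (rep (g \<circ> h)))" by (simp add: sum_distrib_left)
    also have "(\<Sum>h\<in>C. \<phi> (rep (g \<circ> h))) = sum \<phi> C"
      using sum.reindex[OF inj, of \<phi>] img by simp
    finally show ?thesis .
  qed
  then show ?thesis using t(2) unfolding \<phi>_def by blast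
qed

end

section \<open>The cocycle of a pair\<close>

lemma exhaust_4: "x = 0 \<or> x = 1 \<or> x = 2 \<or> x = (3::4)"
proof (cases x)
  case (of_int z)
  then have "z = 0 \<or> z = 1 \<or> z = 2 \<or> z = 3" by auto
  then show ?thesis using of_int by auto
qed

lemma (in sep_closure) sqrt_exists:
  assumes "(2::'k) \<noteq> 0"
  shows "\<exists>w::'o. w ^ 2 = z"
proof (cases "z = 0")
  case False
  have "(2::'o) \<noteq> 0" using assms emb_eq_0_iff[of 2] by (simp del: emb_eq_0_iff)
  then have "\<exists>w. poly [:- z, 0, 1:] w = 0"
    using False by (intro sep_poly_has_root sep_poly_square) simp_all
  then show ?thesis by (auto simp: power2_eq_square)
qed auto

section \<open>Fourth roots of unity, the twisted Galois action and descent to K[sqrt(-D)]\<close>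

locale quadratic_twist = sep_closure e for e :: "'k::field \<Rightarrow> 'o::field" +
  fixes D :: 'k and r i :: 'o
  assumes two: "(2::'k) \<noteq> 0" and D: "D \<noteq> 0" and r: "r ^ 2 = - e D" and i: "i ^ 2 = - 1"
begin

lemma two' [simp]: "(2::'o) \<noteq> 0"
  using two emb_eq_0_iff[of 2] by (simp del: emb_eq_0_iff)

lemma minus_eq_self_iff [simp]: "- x = x \<longleftrightarrow> x = (0::'o)" "x = - x \<longleftrightarrow> x = (0::'o)"
proof -
  have "x = 0" if "x = - x"
  proof -
    have "2 * x = x + x" by simp
    also have "\<dots> = 0" using that by (metis add.right_inverse)
    finally show ?thesis by simp
  qed
  note h = this
  show "- x = x \<longleftrightarrow> x = 0" using h by (metis minus_zero)
  show "x = - x \<longleftrightarrow> x = 0" using h by (metis minus_zero)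
qed

lemma r_nz [simp]: "r \<noteq> 0" using r D by auto

lemma i_nz [simp]: "i \<noteq> 0" using i by auto

lemma i_mult_i [simp]: "i * i = - 1" "i * (i * x) = - x"
  using i by (simp_all add: power2_eq_square mult.assoc[symmetric])

lemma inverse_i [simp]: "inverse i = - i"
  by (rule inverse_unique) simp

lemma r_mult_r: "r * r = - e D" "r * (r * x) = - (e D * x)"
  using r by (simp_all add: power2_eq_square mult.assoc[symmetric])

text \<open>The character sending x to i^x, which identifies the group underlying \<open>M\<close>
  with the fourth roots of unity.\<close>

definition pw :: "4 \<Rightarrow> 'o" where
  "pw x = (if x = 0 then 1 else if x = 1 then i else if x = 2 then - 1 else - i)"

lemma pw_simps [simp]: "pw 0 = 1" "pw 1 = i" "pw 2 = - 1" "pw 3 = - i"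
  by (simp_all add: pw_def)

lemma pw_add: "pw (x + y) = pw x * pw y"
  using exhaust_4[of x] exhaust_4[of y] by (elim disjE) (simp_all add: pw_def)

lemma pw_nz [simp]: "pw x \<noteq> 0"
  by (simp add: pw_def)

lemma pw_minus: "pw (- x) = inverse (pw x)"
  using pw_add[of x "- x"] by (simp add: inverse_unique)

lemma pw_diff: "pw (x - y) = pw x / pw y"
  using pw_add[of x "- y"] by (simp add: pw_minus divide_inverse)

lemma pw_power4 [simp]: "pw x ^ 4 = 1"
  using exhaust_4[of x] by (auto simp: power4_eq_xxxx)

lemma pw_eq_1_iff: "pw x = 1 \<longleftrightarrow> x = 0"
proof -
  have "(- 1 :: 'o) \<noteq> 1" by simp
  moreover have "i \<noteq> 1" "- i \<noteq> 1"
    using i power2_minus[of i] by (metis minus_eq_self_iff(2) one_power2 one_neq_zero)+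
  ultimately show ?thesis using exhaust_4[of x] by auto
qed

lemma pw_inject [simp]: "pw x = pw y \<longleftrightarrow> x = y"
proof
  assume "pw x = pw y"
  then have "pw (x - y) = 1" by (simp add: pw_diff)
  then show "x = y" by (simp add: pw_eq_1_iff)
qed simp

lemma power4_eq_imp_pw:
  assumes "z ^ 4 = w ^ 4" "w \<noteq> 0"
  shows "\<exists>x. z = pw x * w"
proof -
  have "(z - w) * (z + w) * ((z - i * w) * (z + i * w)) = z ^ 4 - w ^ 4"
    by (simp add: power4_eq_xxxx algebra_simps)
  then consider "z = w" | "z = - w" | "z = i * w" | "z = - i * w"
    using assms(1) by (auto simp: eq_neg_iff_add_eq_0)
  then show ?thesis
    by cases (metis pw_simps mult_1 mult_minus_left)+
qed

abbreviation \<chi> :: "('o \<Rightarrow> 'o) \<Rightarrow> 4" where "\<chi> \<equiv> chiD e D"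

lemma galK_r: "g \<in> galK e \<Longrightarrow> g r = r \<or> g r = - r"
  using galK_power[of g r 2] r galK_minus[of g "e D"] galK_emb[of g D] by (metis power2_eq_iff)

lemma galK_i: "g \<in> galK e \<Longrightarrow> g i = i \<or> g i = - i"
  using galK_power[of g i 2] i galK_minus[of g 1] galK_1[of g] by (metis power2_eq_iff)

text \<open>The square roots of D are i r and - i r, and an automorphism fixing one of them fixes
  both.\<close>

lemma chiD_eq:
  assumes "g \<in> galK e"
  shows "\<chi> g = (if g (i * r) = i * r then 1 else - 1)"
proof -
  have "s ^ 2 = e D \<longleftrightarrow> s = i * r \<or> s = - (i * r)" for s
  proof -
    have "(i * r) ^ 2 = e D" by (simp add: power_mult_distrib r i)
    then show ?thesis by (metis power2_eq_iff)
  qed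
  then show ?thesis unfolding chiD_def using galK_minus[OF assms] by auto
qed

lemma chiD_comp: "g \<in> galK e \<Longrightarrow> h \<in> galK e \<Longrightarrow> \<chi> (g \<circ> h) = \<chi> g * \<chi> h"
  using galK_r[of g] galK_r[of h] galK_i[of g] galK_i[of h] 
  by (auto simp: chiD_eq galK_comp galK_mult galK_minus)

text \<open>The sign of g on i is \<open>\<chi> g\<close> times its sign on \<open>r\<close>. Hence
  \<open>M\<close> is the group of fourth roots of unity twisted by the character of sqrt(-D), and
  an inverse appears exactly when g negates \<open>r\<close>.\<close>

lemma galK_pw:
  assumes g: "g \<in> galK e"
  shows "g r = r \<Longrightarrow> g (pw x) = pw (\<chi> g * x)"
    and "g r = - r \<Longrightarrow> g (pw x) * pw (\<chi> g * x) = 1"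
  using galK_i[OF g] exhaust_4[of x]
  by (auto simp: chiD_eq[OF g] galK_hom[OF g] pw_minus)

text \<open>\<open>val\<close> and \<open>cval\<close> are the two \<open>K\<close>-algebra maps sending \<open>sqrt (-D)\<close> to \<open>r\<close> and to \<open>- r\<close>.\<close>
definition val :: "'k \<times> 'k \<Rightarrow> 'o" where
  "val \<alpha> = e (fst \<alpha>) + e (snd \<alpha>) * r"

definition cval :: "'k \<times> 'k \<Rightarrow> 'o" where
  "cval \<alpha> = e (fst \<alpha>) - e (snd \<alpha>) * r"

lemma val_qmul: "val (qmul D \<alpha> \<beta>) = val \<alpha> * val \<beta>"
  by (simp add: val_def qmul_def algebra_simps r_mult_r)

lemma cval_qmul: "cval (qmul D \<alpha> \<beta>) = cval \<alpha> * cval \<beta>"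
  by (simp add: cval_def qmul_def algebra_simps r_mult_r)

lemma val_mult_cval: "val \<alpha> * cval \<alpha> = e (qnorm D \<alpha>)"
  by (simp add: val_def cval_def qnorm_def algebra_simps r_mult_r power2_eq_square)

lemma val_qpow4: "val (qpow4 D \<alpha>) = val \<alpha> ^ 4" "cval (qpow4 D \<alpha>) = cval \<alpha> ^ 4"
  by (simp_all add: qpow4_def val_qmul cval_qmul power4_eq_xxxx)

text \<open>Both values are compared because K[X]/(X^2+D) is not a field when -D is a square in K,
  and \<open>val\<close> alone then has a kernel.\<close>

lemma val_cval_inject:
  assumes "val \<alpha> = val \<beta>" "cval \<alpha> = cval \<beta>"
  shows "\<alpha> = \<beta>"
proof -
  have "2 * e (fst \<alpha>) = val \<alpha> + cval \<alpha>" "2 * e (fst \<beta>) = val \<beta> + cval \<beta>"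
    "2 * (e (snd \<alpha>) * r) = val \<alpha> - cval \<alpha>" "2 * (e (snd \<beta>) * r) = val \<beta> - cval \<beta>"
    by (simp_all add: val_def cval_def)
  then have "2 * e (fst \<alpha>) = 2 * e (fst \<beta>)" "2 * (e (snd \<alpha>) * r) = 2 * (e (snd \<beta>) * r)"
    using assms by simp_all
  then show ?thesis by (simp add: prod_eq_iff)
qed

lemma galK_val:
  assumes "g \<in> galK e"
  shows "g r = r \<Longrightarrow> g (val \<alpha>) = val \<alpha>" "g r = - r \<Longrightarrow> g (val \<alpha>) = cval \<alpha>"
  by (simp_all add: val_def cval_def galK_hom[OF assms])

text \<open>Galois descent for K[X]/(X^2+D): the coordinates of the element sought are (z + z') / 2
  and (z - z') / (2 r), both fixed by every automorphism.\<close>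

lemma val_cval_surj:
  assumes "\<And>g. g \<in> galK e \<Longrightarrow> g r = r \<Longrightarrow> g z = z \<and> g z' = z'"
    and "\<And>g. g \<in> galK e \<Longrightarrow> g r = - r \<Longrightarrow> g z = z' \<and> g z' = z"
  obtains \<alpha> where "val \<alpha> = z" "cval \<alpha> = z'"
proof -
  have "(z + z') / 2 \<in> range e"
  proof (rule galK_fixed_imp_range)
    fix g assume g: "g \<in> galK e"
    have "g 2 = 2" using galK_emb[OF g, of 2] by simp
    then show "g ((z + z') / 2) = (z + z') / 2"
      using galK_r[OF g] assms[OF g] by (auto simp: galK_hom[OF g] add.commute)
  qed
  then obtain x where x: "e x = (z + z') / 2" by auto
  have "(z - z') / (2 * r) \<in> range e"
  proof (rule galK_fixed_imp_range)
    fix g assume g: "g \<in> galK e"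
    have "g 2 = 2" using galK_emb[OF g, of 2] by simp
    then show "g ((z - z') / (2 * r)) = (z - z') / (2 * r)"
      using galK_r[OF g] assms[OF g] by (auto simp: galK_hom[OF g] field_simps)
  qed
  then obtain y where y: "e y = (z - z') / (2 * r)" by auto
  have yr: "e y * r = (z - z') / 2" unfolding y by simp
  have "val (x, y) = ((z + z') + (z - z')) / 2" "cval (x, y) = ((z + z') - (z - z')) / 2"
    by (simp_all only: val_def cval_def fst_conv snd_conv x yr add_divide_distrib diff_divide_distrib)
  moreover have "(z + z') + (z - z') = 2 * z" "(z + z') - (z - z') = 2 * z'" by simp_all
  ultimately have "val (x, y) = z" "cval (x, y) = z'" by simp_all
  then show ?thesis using that by blast
qed

text \<open>The last conjunct says \<open>g w = c / (i^(\<sigma> g) w)\<close>: an automorphism negating \<open>r\<close> sends \<open>w\<close> to a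
  fourth root of the conjugate of \<open>\<alpha>\<close>, and these are the \<open>c / w'\<close> with \<open>w'^4 = \<alpha>\<close>.\<close>
definition kummer :: "('k \<times> 'k) \<times> 'k \<Rightarrow> 'o \<Rightarrow> (('o \<Rightarrow> 'o) \<Rightarrow> 4) \<Rightarrow> bool" where
  "kummer p w \<sigma> \<longleftrightarrow> w ^ 4 = val (fst p) \<and> (\<forall>g. g \<notin> galK e \<longrightarrow> \<sigma> g = 0)
     \<and> (\<forall>g\<in>galK e. (g r = r \<longrightarrow> g w = pw (\<sigma> g) * w) \<and> (g r = - r \<longrightarrow> g w * pw (\<sigma> g) * w = e (snd p)))"

section \<open>Existence, uniqueness and triviality of the cocycle of a pair\<close>

lemma pair_carrierD:
  assumes "p \<in> carrier (pair_group D)"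
  shows "snd p \<noteq> 0" "val (fst p) * cval (fst p) = e (snd p) ^ 4" "val (fst p) \<noteq> 0" "cval (fst p) \<noteq> 0"
proof -
  have n: "qnorm D (fst p) = snd p ^ 4" and c: "snd p \<noteq> 0"
    using assms unfolding pair_group_def by auto
  show "snd p \<noteq> 0" by (rule c)
  show v: "val (fst p) * cval (fst p) = e (snd p) ^ 4"
    unfolding val_mult_cval n by simp
  then show "val (fst p) \<noteq> 0" "cval (fst p) \<noteq> 0" using c by auto
qed

lemma kummerD:
  assumes "p \<in> carrier (pair_group D)" "kummer p w \<sigma>"
  shows "w \<noteq> 0" "w ^ 4 = val (fst p)" "(e (snd p) / w) ^ 4 = cval (fst p)"
proof -
  show w: "w ^ 4 = val (fst p)" using assms unfolding kummer_def by blast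
  then show w0: "w \<noteq> 0" using pair_carrierD(3)[OF assms(1)] by auto
  show "(e (snd p) / w) ^ 4 = cval (fst p)"
    using pair_carrierD[OF assms(1)] unfolding power_divide w by (simp add: field_simps)
qed

text \<open>If g fixes \<open>r\<close>, then g w is again a fourth root of \<alpha>; if g negates
  \<open>r\<close>, then (g w * w)^4 = N(\<alpha>) = c^4. Either way the discrepancy is a power of
  i.\<close>

lemma kummer_exists:
  assumes p: "p \<in> carrier (pair_group D)"
  shows "\<exists>w \<sigma>. kummer p w \<sigma>"
proof -
  obtain z w where "z ^ 2 = val (fst p)" "w ^ 2 = z" using sqrt_exists[OF two] by metis
  then have w: "w ^ 4 = val (fst p)" by auto
  have w0: "w \<noteq> 0" using w pair_carrierD(3)[OF p] by auto
  have "\<exists>s. (g \<notin> galK e \<longrightarrow> s = 0) \<and> (g \<in> galK e \<longrightarrow> (g r = r \<longrightarrow> g w = pw s * w)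
      \<and> (g r = - r \<longrightarrow> g w * pw s * w = e (snd p)))" for g
  proof (cases "g \<in> galK e")
    case g: True
    show ?thesis
    proof (cases "g r = r")
      case True
      then have "(g w) ^ 4 = w ^ 4"
        using galK_power[OF g, of w 4] w galK_val(1)[OF g True, of "fst p"] by simp
      then obtain s where "g w = pw s * w" using power4_eq_imp_pw w0 by blast
      with True g show ?thesis by auto
    next
      case False
      then have gr: "g r = - r" using galK_r[OF g] by blast
      then have "(g w) ^ 4 = cval (fst p)"
        using galK_power[OF g, of w 4] w galK_val(2)[OF g gr, of "fst p"] by simp
      then have "(g w * w) ^ 4 = e (snd p) ^ 4"
        using w pair_carrierD(2)[OF p] by (simp add: power_mult_distrib mult.commute)
      then obtain s where s: "g w * w = pw s * e (snd p)"
        using power4_eq_imp_pw pair_carrierD(1)[OF p] by (metis emb_eq_0_iff)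
      \<comment> \<open>In \<open>kummer\<close> the power of i stands on the side of g w, hence the
        sign of the exponent.\<close>
      have "g w * pw (- s) * w = inverse (pw s) * (g w * w)" by (simp add: pw_minus)
      also have "\<dots> = e (snd p)" unfolding s by simp
      finally show ?thesis using gr g False by blast
    qed
  qed simp
  then obtain \<sigma> where "\<forall>g. (g \<notin> galK e \<longrightarrow> \<sigma> g = 0) \<and> (g \<in> galK e \<longrightarrow> (g r = r \<longrightarrow> g w = pw (\<sigma> g) * w)
      \<and> (g r = - r \<longrightarrow> g w * pw (\<sigma> g) * w = e (snd p)))" by metis
  then show ?thesis unfolding kummer_def using w by blast
qed

text \<open>Two expressions for g (h w) are compared, in four cases according to the signs of g and
  h on \<open>r\<close>; \<open>galK_pw\<close> turns the action of g on i^(\<sigma> h) into the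
  twist by \<open>\<chi> g\<close>. Continuity holds because \<sigma> vanishes on the stabiliser of
  \<open>r\<close> and \<open>w\<close>.\<close>

lemma kummer_in_Z1:
  assumes p: "p \<in> carrier (pair_group D)" and k: "kummer p w \<sigma>"
  shows "\<sigma> \<in> Z1 e D"
proof -
  let ?c = "e (snd p)"
  have w0: "w \<noteq> 0" using kummerD(1)[OF p k] .
  have c0: "?c \<noteq> 0" using pair_carrierD(1)[OF p] by simp
  have k1: "g w = pw (\<sigma> g) * w" if "g \<in> galK e" "g r = r" for g
    using k that unfolding kummer_def by blast
  have k2: "g w * pw (\<sigma> g) * w = ?c" if "g \<in> galK e" "g r = - r" for g
    using k that unfolding kummer_def by blast
  have "\<sigma> (g \<circ> h) = \<sigma> g + \<chi> g * \<sigma> h" if g: "g \<in> galK e" and h: "h \<in> galK e" for g h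
  proof -
    have gh: "g \<circ> h \<in> galK e" using galK_comp[OF g h] .
    let ?B = "pw (\<chi> g * \<sigma> h)"
    have gc: "g ?c = ?c" using galK_emb[OF g] .
    have "pw (\<sigma> (g \<circ> h)) = pw (\<sigma> g) * ?B"
      using galK_r[OF g] galK_r[OF h]
    proof (elim disjE)
      assume gr: "g r = r" and hr: "h r = r"
      have "(g \<circ> h) w = pw (\<sigma> (g \<circ> h)) * w" using k1[OF gh] gr hr by simp
      moreover have "(g \<circ> h) w = ?B * (pw (\<sigma> g) * w)"
        using k1[OF h hr] k1[OF g gr] galK_pw(1)[OF g gr] by (simp add: galK_mult[OF g])
      ultimately show ?thesis using w0 by simp
    next
      assume gr: "g r = r" and hr: "h r = - r"
      have 1: "g (h w) * pw (\<sigma> (g \<circ> h)) * w = ?c" using k2[OF gh] gr hr by (simp add: galK_minus[OF g])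
      have "g (h w * pw (\<sigma> h) * w) = g ?c" using k2[OF h hr] by simp
      then have 2: "g (h w) * ?B * (pw (\<sigma> g) * w) = ?c"
        using k1[OF g gr] galK_pw(1)[OF g gr] gc by (simp add: galK_mult[OF g])
      have "g (h w) \<noteq> 0" using 1 c0 by auto
      moreover have "(g (h w) * w) * pw (\<sigma> (g \<circ> h)) = (g (h w) * w) * (pw (\<sigma> g) * ?B)"
        using 1 2 by (simp add: mult_ac)
      ultimately show ?thesis using w0 by simp
    next
      assume gr: "g r = - r" and hr: "h r = r"
      have 1: "g (h w) * pw (\<sigma> (g \<circ> h)) * w = ?c" using k2[OF gh] gr hr by simp
      have 2: "g (h w) = g (pw (\<sigma> h)) * g w" using k1[OF h hr] by (simp add: galK_mult[OF g])
      have 3: "g (pw (\<sigma> h)) * ?B = 1" using galK_pw(2)[OF g gr] .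
      have 4: "g w * pw (\<sigma> g) * w = ?c" using k2[OF g gr] .
      have "g w \<noteq> 0" using 4 c0 by auto
      have "(g w * w) * (pw (\<sigma> g) * ?B) = ?c * ?B" using 4 by (simp add: mult_ac)
      also have "\<dots> = (g w * w) * pw (\<sigma> (g \<circ> h)) * (g (pw (\<sigma> h)) * ?B)"
        unfolding 1[symmetric] 2 by (simp add: mult_ac)
      finally show ?thesis using 3 w0 \<open>g w \<noteq> 0\<close> by simp
    next
      assume gr: "g r = - r" and hr: "h r = - r"
      have 1: "g (h w) = pw (\<sigma> (g \<circ> h)) * w" using k1[OF gh] gr hr by (simp add: galK_minus[OF g])
      have "g (h w * pw (\<sigma> h) * w) = g ?c" using k2[OF h hr] by simp
      then have 2: "g (h w) * g (pw (\<sigma> h)) * g w = ?c" using gc by (simp add: galK_mult[OF g])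
      have 3: "g (pw (\<sigma> h)) * ?B = 1" using galK_pw(2)[OF g gr] .
      have 4: "g w * pw (\<sigma> g) * w = ?c" using k2[OF g gr] .
      have "g w \<noteq> 0" using 4 c0 by auto
      have "(g w * w) * (pw (\<sigma> g) * ?B) = ?c * ?B" using 4 by (simp add: mult_ac)
      also have "\<dots> = (g w * w) * pw (\<sigma> (g \<circ> h)) * (g (pw (\<sigma> h)) * ?B)"
        unfolding 2[symmetric] 1 by (simp add: mult_ac)
      finally show ?thesis using 3 w0 \<open>g w \<noteq> 0\<close> by simp
    qed
    then show ?thesis unfolding pw_add[symmetric] by simp
  qed
  moreover have "\<sigma> g = 0" if "g \<in> galK e" "\<forall>s\<in>{r, w}. g s = s" for g
  proof -
    have "pw (\<sigma> g) * w = w" using k1[of g] that by simp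
    then show ?thesis using w0 by (simp add: pw_eq_1_iff)
  qed
  then have "\<exists>S. finite S \<and> (\<forall>g\<in>galK e. (\<forall>s\<in>S. g s = s) \<longrightarrow> \<sigma> g = 0)"
    by (intro exI[of _ "{r, w}"]) blast
  moreover have "\<forall>g. g \<notin> galK e \<longrightarrow> \<sigma> g = 0" using k unfolding kummer_def by blast
  ultimately show ?thesis unfolding Z1_def by blast
qed

text \<open>The root w is determined by \<alpha> only up to a power of i. This ambiguity accounts
  exactly for the coboundaries.\<close>

lemma kummer_shift:
  assumes k: "kummer p w \<sigma>"
  shows "kummer p (pw m * w) (\<lambda>g. \<sigma> g + (if g \<in> galK e then \<chi> g * m - m else 0))"
  unfolding kummer_def
proof (intro conjI allI ballI impI)
  show "(pw m * w) ^ 4 = val (fst p)" using k unfolding kummer_def by (simp add: power_mult_distrib)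
  show "g \<notin> galK e \<Longrightarrow> \<sigma> g + (if g \<in> galK e then \<chi> g * m - m else 0) = 0" for g
    using k unfolding kummer_def by simp
  fix g assume g: "g \<in> galK e"
  { assume gr: "g r = r"
    have "g w = pw (\<sigma> g) * w" using k g gr unfolding kummer_def by blast
    then show "g (pw m * w) = pw (\<sigma> g + (if g \<in> galK e then \<chi> g * m - m else 0)) * (pw m * w)"
      using g by (simp add: galK_mult[OF g] galK_pw(1)[OF g gr] pw_add pw_diff) }
  { assume gr: "g r = - r"
    have 1: "g w * pw (\<sigma> g) * w = e (snd p)" using k g gr unfolding kummer_def by blast
    have "g (pw m * w) * pw (\<sigma> g + (\<chi> g * m - m)) * (pw m * w)
        = (g (pw m) * pw (\<chi> g * m)) * (g w * pw (\<sigma> g) * w)"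
      by (simp add: galK_mult[OF g] pw_add pw_diff)
    then show "g (pw m * w) * pw (\<sigma> g + (if g \<in> galK e then \<chi> g * m - m else 0)) * (pw m * w) = e (snd p)"
      using g by (simp add: galK_pw(2)[OF g gr] 1) }
qed

lemma kummer_inject:
  assumes p: "p \<in> carrier (pair_group D)" and "kummer p w \<sigma>" "kummer p w \<tau>"
  shows "\<sigma> = \<tau>"
proof
  fix g
  have w0: "w \<noteq> 0" using kummerD(1)[OF assms(1,2)] .
  show "\<sigma> g = \<tau> g"
  proof (cases "g \<in> galK e")
    case False
    then show ?thesis using assms unfolding kummer_def by auto
  next
    case g: True
    show ?thesis
      using galK_r[OF g]
    proof
      assume "g r = r"
      then have "pw (\<sigma> g) * w = pw (\<tau> g) * w" using assms g unfolding kummer_def by metis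
      then show ?thesis using w0 by simp
    next
      assume "g r = - r"
      then have "g w * pw (\<sigma> g) * w = g w * pw (\<tau> g) * w" using assms g unfolding kummer_def by metis
      then show ?thesis using w0 galK_eq_0_iff[OF g, of w] by simp
    qed
  qed
qed

lemma kummer_unique:
  assumes p: "p \<in> carrier (pair_group D)" and k: "kummer p w \<sigma>" "kummer p z \<tau>"
  shows "\<exists>b\<in>B1 e D. \<tau> = (\<lambda>g. b g + \<sigma> g)"
proof -
  have "z ^ 4 = w ^ 4" using kummerD(2)[OF p k(1)] kummerD(2)[OF p k(2)] by simp
  then obtain m where "z = pw m * w" using power4_eq_imp_pw kummerD(1)[OF p k(1)] by blast
  then have "\<tau> = (\<lambda>g. \<sigma> g + (if g \<in> galK e then \<chi> g * m - m else 0))"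
    using kummer_inject[OF p k(2)] kummer_shift[OF k(1)] by blast
  then have "\<tau> = (\<lambda>g. (if g \<in> galK e then \<chi> g * m - m else 0) + \<sigma> g)" by (simp add: add.commute)
  then show ?thesis
    unfolding B1_def by (intro bexI[of _ "\<lambda>g. if g \<in> galK e then \<chi> g * m - m else 0"]) auto
qed

lemma kummer_mult:
  assumes "kummer p w \<sigma>" "kummer q z \<tau>"
  shows "kummer (p \<otimes>\<^bsub>pair_group D\<^esub> q) (w * z) (\<lambda>g. \<sigma> g + \<tau> g)"
  unfolding kummer_def
proof (intro conjI allI ballI impI)
  show "(w * z) ^ 4 = val (fst (p \<otimes>\<^bsub>pair_group D\<^esub> q))"
    using assms unfolding kummer_def by (simp add: pair_group_def val_qmul power_mult_distrib)
  show "g \<notin> galK e \<Longrightarrow> \<sigma> g + \<tau> g = 0" for g using assms unfolding kummer_def by simp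
  fix g assume g: "g \<in> galK e"
  show "g (w * z) = pw (\<sigma> g + \<tau> g) * (w * z)" if "g r = r"
  proof -
    have "g w = pw (\<sigma> g) * w" "g z = pw (\<tau> g) * z"
      using assms g that unfolding kummer_def by blast+
    then show ?thesis by (simp add: galK_mult[OF g] pw_add)
  qed
  assume gr: "g r = - r"
  have 1: "g w * pw (\<sigma> g) * w = e (snd p)" "g z * pw (\<tau> g) * z = e (snd q)"
    using assms g gr unfolding kummer_def by blast+
  have "g (w * z) * pw (\<sigma> g + \<tau> g) * (w * z) = (g w * pw (\<sigma> g) * w) * (g z * pw (\<tau> g) * z)"
    by (simp add: galK_mult[OF g] pw_add mult_ac)
  then show "g (w * z) * pw (\<sigma> g + \<tau> g) * (w * z) = e (snd (p \<otimes>\<^bsub>pair_group D\<^esub> q))"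
    unfolding 1 by (simp add: pair_group_def)
qed

lemma kummer_pair_sub:
  assumes "p \<in> pair_sub D"
  shows "\<exists>w. kummer p w (\<lambda>_. 0)"
proof -
  obtain \<beta> where p: "p = (qpow4 D \<beta>, qnorm D \<beta>)" using assms unfolding pair_sub_def by blast
  \<comment> \<open>The natural fourth root of the value of \<beta>^4 is the value of \<beta>, which
    each automorphism either fixes or sends to the conjugate value.\<close>
  have "kummer p (val \<beta>) (\<lambda>_. 0)"
    unfolding kummer_def p using galK_val by (simp add: val_qpow4 val_mult_cval[symmetric] mult.commute)
  then show ?thesis by blast
qed

text \<open>For the trivial cocycle every automorphism fixes both w and c / w or exchanges them. By
  descent they are the two values of some \<beta>, whose norm is their product c.\<close>

lemma kummer_trivial_imp_pair_sub:
  assumes p: "p \<in> carrier (pair_group D)" and k: "kummer p w (\<lambda>_. 0)"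
  shows "p \<in> pair_sub D"
proof -
  let ?z = "e (snd p) / w"
  have w0: "w \<noteq> 0" using kummerD(1)[OF p k] .
  have k1: "g w = w" if "g \<in> galK e" "g r = r" for g
    using k that unfolding kummer_def by simp
  have k2: "g w = ?z" if "g \<in> galK e" "g r = - r" for g
    using k that w0 unfolding kummer_def by (simp add: field_simps)
  obtain \<beta> where \<beta>: "val \<beta> = w" "cval \<beta> = ?z"
  proof (rule val_cval_surj[of w ?z])
    fix g assume g: "g \<in> galK e"
    show "g r = r \<Longrightarrow> g w = w \<and> g ?z = ?z" using k1[OF g] by (simp add: galK_hom[OF g])
    show "g r = - r \<Longrightarrow> g w = ?z \<and> g ?z = w"
      using k2[OF g] pair_carrierD(1)[OF p] by (simp add: galK_hom[OF g])
  qed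
  have "e (qnorm D \<beta>) = e (snd p)" using val_mult_cval[of \<beta>] w0 unfolding \<beta> by simp
  then have n: "qnorm D \<beta> = snd p" by simp
  have "qpow4 D \<beta> = fst p"
    by (rule val_cval_inject) (simp_all only: val_qpow4 \<beta> kummerD[OF p k])
  with n have "p = (qpow4 D \<beta>, qnorm D \<beta>)" by simp
  moreover have "\<beta> \<in> qunits D" using n pair_carrierD(1)[OF p] by (simp add: qunits_def)
  ultimately show ?thesis unfolding pair_sub_def by blast
qed

end

section \<open>Surjectivity and the quartic algebra\<close>

context quadratic_twist
begin

text \<open>On the stabiliser of \<open>r\<close> the cocycle has values in the fourth roots of
  unity with their usual action, and Hilbert 90 supplies w. A companion z in the role of c / w is
  then constructed; w^4 and z^4 descend to \<alpha>, and w z to c.\<close>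

lemma kummer_surj:
  assumes \<sigma>: "\<sigma> \<in> Z1 e D"
  shows "\<exists>p w. p \<in> carrier (pair_group D) \<and> kummer p w \<sigma>"
proof -
  have out: "\<forall>g. g \<notin> galK e \<longrightarrow> \<sigma> g = 0"
    and coc: "\<And>g h. g \<in> galK e \<Longrightarrow> h \<in> galK e \<Longrightarrow> \<sigma> (g \<circ> h) = \<sigma> g + \<chi> g * \<sigma> h"
    using \<sigma> unfolding Z1_def by blast+
  have "\<exists>S. finite S \<and> (\<forall>g\<in>galK e. (\<forall>s\<in>S. g s = s) \<longrightarrow> \<sigma> g = 0)"
    using \<sigma> unfolding Z1_def by (elim CollectE conjE)
  then obtain S where S: "finite S" "\<forall>g\<in>galK e. (\<forall>s\<in>S. g s = s) \<longrightarrow> \<sigma> g = 0"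
    by (elim exE conjE)
  let ?H = "{g \<in> galK e. g r = r}"
  have "\<exists>w. w \<noteq> 0 \<and> (\<forall>g\<in>?H. g w = pw (\<sigma> g) * w)"
  proof (rule hilbert90)
    show "inv_into UNIV g \<in> ?H" if "g \<in> ?H" for g
      using that galK_inv galK_bij by (auto intro: inv_f_eq simp: bij_is_inj)
    show "pw (\<sigma> (g \<circ> h)) = pw (\<sigma> g) * g (pw (\<sigma> h))" if "g \<in> ?H" "h \<in> ?H" for g h
      using that coc galK_pw(1) by (simp add: pw_add)
    show "finite S" by (rule S)
    show "pw (\<sigma> g) = 1" if "g \<in> ?H" "\<And>s. s \<in> S \<Longrightarrow> g s = s" for g
      using bspec[OF S(2), of g] that by simp
  qed (use galK_id galK_comp in auto)
  then obtain w where w0: "w \<noteq> 0" and w: "\<And>g. g \<in> galK e \<Longrightarrow> g r = r \<Longrightarrow> g w = pw (\<sigma> g) * w"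
    by blast
  have "\<exists>z. z \<noteq> 0 \<and> (\<forall>g\<in>galK e. (g r = r \<longrightarrow> g z * pw (\<sigma> g) = z)
      \<and> (g r = - r \<longrightarrow> g w * pw (\<sigma> g) = z \<and> g z = pw (\<sigma> g) * w))"
  proof (cases "\<exists>\<tau>\<in>galK e. \<tau> r = - r")
    case False
    \<comment> \<open>Here \<open>r\<close> lies in K and no automorphism links z to w. The inverse
      of w transforms in the required way and leads to c = 1.\<close>
    have "g (inverse w) * pw (\<sigma> g) = inverse w" if "g \<in> galK e" for g
      using False galK_r[OF that] w[OF that] that by (auto simp: galK_inverse)
    then show ?thesis using False w0 by (intro exI[of _ "inverse w"]) auto
  next
    case True
    then obtain \<tau> where \<tau>: "\<tau> \<in> galK e" "\<tau> r = - r" by blast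
    \<comment> \<open>The relation \<tau> w * i^(\<sigma> \<tau>) * w = c demanded by
      \<open>kummer\<close> forces this value for c / w.\<close>
    define z where "z = pw (\<sigma> \<tau>) * \<tau> w"
    have z0: "z \<noteq> 0" unfolding z_def using w0 galK_eq_0_iff[OF \<tau>(1)] by simp
    \<comment> \<open>The value is the same for every automorphism negating \<open>r\<close>: such a
      g is \<tau> followed on the right by some h fixing \<open>r\<close>, whose effect on w is
      known.\<close>
    have neg: "g w * pw (\<sigma> g) = z" if g: "g \<in> galK e" "g r = - r" for g
    proof -
      define h where "h = inv_into UNIV \<tau> \<circ> g"
      have h: "h \<in> galK e" unfolding h_def using \<tau>(1) g(1) by (intro galK_comp galK_inv)
      have gh: "g = \<tau> \<circ> h" unfolding h_def using galK_comp_inv(1)[OF \<tau>(1)] by (simp add: o_assoc)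
      have "\<tau> (h r) = \<tau> r" using gh g(2) \<tau>(2) by simp
      then have hr: "h r = r" using galK_bij[OF \<tau>(1)] by (simp add: bij_is_inj inj_eq)
      have "g w * pw (\<sigma> g) = \<tau> (pw (\<sigma> h) * w) * pw (\<sigma> \<tau> + \<chi> \<tau> * \<sigma> h)"
        unfolding gh comp_apply w[OF h hr] coc[OF \<tau>(1) h] ..
      also have "\<dots> = (\<tau> (pw (\<sigma> h)) * pw (\<chi> \<tau> * \<sigma> h)) * z"
        unfolding z_def by (simp add: galK_mult[OF \<tau>(1)] pw_add mult_ac)
      also have "\<dots> = z" using galK_pw(2)[OF \<tau>] by simp
      finally show ?thesis .
    qed
    have fixes_z: "g z * pw (\<sigma> g) = z" if g: "g \<in> galK e" "g r = r" for g
    proof -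
      have "(g \<circ> \<tau>) w * pw (\<sigma> (g \<circ> \<tau>)) = z"
        using neg[OF galK_comp[OF g(1) \<tau>(1)]] g \<tau> by (simp add: galK_minus)
      then show ?thesis
        unfolding z_def coc[OF g(1) \<tau>(1)]
        by (simp add: galK_mult[OF g(1)] pw_add galK_pw(1)[OF g] mult_ac)
    qed
    have swap: "g z = pw (\<sigma> g) * w" if g: "g \<in> galK e" "g r = - r" for g
    proof -
      have "(g \<circ> \<tau>) w = pw (\<sigma> g + \<chi> g * \<sigma> \<tau>) * w"
        using w[OF galK_comp[OF g(1) \<tau>(1)]] coc[OF g(1) \<tau>(1)] g \<tau> by (simp add: galK_minus)
      then have "g z = (g (pw (\<sigma> \<tau>)) * pw (\<chi> g * \<sigma> \<tau>)) * (pw (\<sigma> g) * w)"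
        unfolding z_def by (simp add: galK_mult[OF g(1)] pw_add mult_ac)
      then show ?thesis using galK_pw(2)[OF g] by simp
    qed
    show ?thesis using z0 neg fixes_z swap by blast
  qed
  then obtain z where z0: "z \<noteq> 0"
    and z1: "\<And>g. g \<in> galK e \<Longrightarrow> g r = r \<Longrightarrow> g z * pw (\<sigma> g) = z"
    and z2: "\<And>g. g \<in> galK e \<Longrightarrow> g r = - r \<Longrightarrow> g w * pw (\<sigma> g) = z"
    and z3: "\<And>g. g \<in> galK e \<Longrightarrow> g r = - r \<Longrightarrow> g z = pw (\<sigma> g) * w" by blast
  obtain \<alpha> where \<alpha>: "val \<alpha> = w ^ 4" "cval \<alpha> = z ^ 4"
  proof (rule val_cval_surj[of "w ^ 4" "z ^ 4"])
    fix g assume g: "g \<in> galK e"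
    { assume gr: "g r = r"
      have "(g z * pw (\<sigma> g)) ^ 4 = z ^ 4" using z1[OF g gr] by simp
      then show "g (w ^ 4) = w ^ 4 \<and> g (z ^ 4) = z ^ 4"
        by (simp add: galK_power[OF g] w[OF g gr] power_mult_distrib) }
    { assume gr: "g r = - r"
      have "(g w * pw (\<sigma> g)) ^ 4 = z ^ 4" using z2[OF g gr] by simp
      then show "g (w ^ 4) = z ^ 4 \<and> g (z ^ 4) = w ^ 4"
        by (simp add: galK_power[OF g] z3[OF g gr] power_mult_distrib) }
  qed
  have "w * z \<in> range e"
  proof (rule galK_fixed_imp_range)
    fix g assume g: "g \<in> galK e"
    show "g (w * z) = w * z"
      using galK_r[OF g]
    proof
      assume gr: "g r = r"
      have "g (w * z) = w * (g z * pw (\<sigma> g))" by (simp add: galK_mult[OF g] w[OF g gr])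
      then show ?thesis using z1[OF g gr] by simp
    next
      assume gr: "g r = - r"
      have "g (w * z) = w * (g w * pw (\<sigma> g))" by (simp add: galK_mult[OF g] z3[OF g gr])
      then show ?thesis using z2[OF g gr] by simp
    qed
  qed
  then obtain c where c: "e c = w * z" by auto
  have "e (qnorm D \<alpha>) = e (c ^ 4)" using val_mult_cval[of \<alpha>] \<alpha> c by (simp add: power_mult_distrib)
  then have n: "qnorm D \<alpha> = c ^ 4" by (simp del: emb_power)
  have c0: "c \<noteq> 0" using c w0 z0 by auto
  have "(\<alpha>, c) \<in> carrier (pair_group D)" using n c0 by (simp add: pair_group_def qunits_def)
  moreover have "kummer (\<alpha>, c) w \<sigma>"
    unfolding kummer_def using out \<alpha> c w z2 by (simp add: mult.commute)
  ultimately show ?thesis by blast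
qed

text \<open>The points of the algebra are labelled by the fourth roots t = i^x w through u = t^2 +
  (c/t)^2 and v = t + c/t. These satisfy the defining equations since t^4 + (c/t)^4 is the trace 2a
  of \<alpha>.\<close>

lemma kummer_corresponds:
  assumes p: "((a, b), c) \<in> carrier (pair_group D)" and k: "kummer ((a, b), c) w \<sigma>"
    and card4: "card (L_coords e a c) = 4"
  shows "corresponds e D \<sigma> (L_coords e a c)"
proof -
  define J where "J t = (t ^ 2 + (e c / t) ^ 2, t + e c / t)" for t
  define \<iota> where "\<iota> x = J (pw x * w)" for x
  have w0: "w \<noteq> 0" using kummerD(1)[OF p k] .
  have c0: "e c \<noteq> 0" using pair_carrierD(1)[OF p] by simp
  have val: "w ^ 4 = e a + e b * r" "(e c / w) ^ 4 = e a - e b * r"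
    using kummerD(2,3)[OF p k] by (simp_all add: val_def cval_def)
  have sq1: "(t ^ 2 + (e c / t) ^ 2) ^ 2 = t ^ 4 + (e c / t) ^ 4 + 2 * e c ^ 2" if "t \<noteq> 0" for t
    using that by (simp add: power2_sum power_divide)
  have sq2: "(t + e c / t) ^ 2 = e (2 * c) + (t ^ 2 + (e c / t) ^ 2)" if "t \<noteq> 0" for t
    using that by (simp add: power2_sum)
  have pw4: "(pw x * w) ^ 4 + (e c / (pw x * w)) ^ 4 + 2 * e c ^ 2 = e (2 * a + 2 * c ^ 2)" for x
  proof -
    have "(pw x * w) ^ 4 + (e c / (pw x * w)) ^ 4 = w ^ 4 + (e c / w) ^ 4"
      by (simp add: power_mult_distrib power_divide)
    also have "\<dots> = e (2 * a)" unfolding val by simp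
    finally show ?thesis by simp
  qed
  have "range \<iota> = L_coords e a c"
  proof (intro equalityI subsetI)
    fix y assume "y \<in> range \<iota>"
    then show "y \<in> L_coords e a c"
      using w0 by (auto simp: \<iota>_def J_def L_coords_def sq1 sq2 pw4 simp del: emb_mult emb_add emb_power)
  next
    fix y assume "y \<in> L_coords e a c"
    then obtain u v where y: "y = (u, v)" and u: "u ^ 2 = e (2 * a + 2 * c ^ 2)" and v: "v ^ 2 = e (2 * c) + u"
      unfolding L_coords_def by blast
    have "u ^ 2 = (fst (\<iota> 0)) ^ 2"
      unfolding u pw4[of 0, symmetric] using w0 by (simp add: \<iota>_def J_def sq1)
    \<comment> \<open>Multiplying t by i changes the sign of u, and multiplying it by -1 changes
      that of v alone, so all sign choices are reached.\<close>
    moreover have "fst (\<iota> 1) = - fst (\<iota> 0)"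
      by (simp add: \<iota>_def J_def power_mult_distrib power_divide i)
    ultimately obtain x where x: "u = fst (\<iota> x)" by (metis power2_eq_iff)
    have "v ^ 2 = (snd (\<iota> x)) ^ 2"
      unfolding v x using w0 by (simp add: \<iota>_def J_def sq2 del: emb_mult)
    moreover have "\<iota> (x + 2) = (fst (\<iota> x), - snd (\<iota> x))"
      by (simp add: \<iota>_def J_def pw_add)
    ultimately have "y = \<iota> x \<or> y = \<iota> (x + 2)"
      unfolding y x by (metis power2_eq_iff prod.collapse)
    then show "y \<in> range \<iota>" by blast
  qed
  \<comment> \<open>The four-element index type maps onto a set of four elements, so the labelling
    is injective.\<close>
  moreover from this have "inj \<iota>"
    using card4 by (intro eq_card_imp_inj_on) simp_all
  ultimately have "bij_betw \<iota> UNIV (L_coords e a c)" by (simp add: bij_betw_def)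
  moreover have "map_prod g g (\<iota> x) = \<iota> (\<chi> g * x + \<sigma> g)" if g: "g \<in> galK e" for g x
  proof -
    have gJ: "map_prod g g (J t) = J (g t)" for t
      unfolding J_def by (simp add: galK_hom[OF g])
    show ?thesis
      using galK_r[OF g]
    proof
      assume gr: "g r = r"
      have "g w = pw (\<sigma> g) * w" using k g gr unfolding kummer_def by blast
      then have "g (pw x * w) = pw (\<chi> g * x + \<sigma> g) * w"
        by (simp add: galK_mult[OF g] galK_pw(1)[OF g gr] pw_add)
      then show ?thesis unfolding \<iota>_def gJ by simp
    next
      assume gr: "g r = - r"
      \<comment> \<open>An automorphism negating \<open>r\<close> sends t to some c / t'. The
        symmetry of \<open>J\<close> under this exchange turns c / t' back into the label
        t'.\<close>
      have J_swap: "J (e c / t) = J t" if "t \<noteq> 0" for t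
        using that c0 by (simp add: J_def add.commute)
      have 1: "g w * pw (\<sigma> g) * w = e c" using k g gr unfolding kummer_def by auto
      have "g (pw x * w) * (pw (\<chi> g * x + \<sigma> g) * w)
          = (g (pw x) * pw (\<chi> g * x)) * (g w * pw (\<sigma> g) * w)"
        by (simp add: galK_mult[OF g] pw_add mult_ac)
      also have "\<dots> = e c" using galK_pw(2)[OF g gr] 1 by simp
      finally have "g (pw x * w) = e c / (pw (\<chi> g * x + \<sigma> g) * w)"
        using w0 by (simp add: field_simps)
      then show ?thesis unfolding \<iota>_def gJ using J_swap w0 by simp
    qed
  qed
  ultimately show ?thesis unfolding corresponds_def by blast
qed

section \<open>The isomorphism\<close>

lemma comm_group_pair_group: "comm_group (pair_group D)"
proof (rule comm_groupI)
  have norm: "qnorm D (qmul D x y) = qnorm D x * qnorm D y" for x y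
    by (simp add: qnorm_def qmul_def power2_eq_square algebra_simps)
  fix x y assume x: "x \<in> carrier (pair_group D)" and y: "y \<in> carrier (pair_group D)"
  show "x \<otimes>\<^bsub>pair_group D\<^esub> y \<in> carrier (pair_group D)"
    using x y by (auto simp: pair_group_def qunits_def norm power_mult_distrib)
  show "x \<otimes>\<^bsub>pair_group D\<^esub> y = y \<otimes>\<^bsub>pair_group D\<^esub> x"
    by (simp add: pair_group_def qmul_def algebra_simps)
  show "\<exists>y\<in>carrier (pair_group D). y \<otimes>\<^bsub>pair_group D\<^esub> x = \<one>\<^bsub>pair_group D\<^esub>"
  proof -
    obtain a b c where abc: "x = ((a, b), c)" by (metis prod.collapse)
    let ?N = "a ^ 2 + D * b ^ 2"
    have N: "?N = c ^ 4" and c0: "c \<noteq> 0" and N0: "?N \<noteq> 0"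
      using x unfolding abc by (auto simp: pair_group_def qnorm_def qunits_def)
    have sum: "a * a / ?N + D * b * b / ?N = 1"
      using N0 by (simp add: add_divide_distrib[symmetric] power2_eq_square mult.assoc)
    let ?y = "((a / ?N, - b / ?N), 1 / c)"
    have "qnorm D (a / ?N, - b / ?N) = ?N / ?N ^ 2"
      by (simp add: qnorm_def power_divide add_divide_distrib)
    also have "\<dots> = (1 / c) ^ 4" using c0 unfolding N by (simp add: field_simps power_divide)
    finally have "?y \<in> carrier (pair_group D)" using c0 by (simp add: pair_group_def qunits_def)
    moreover have "?y \<otimes>\<^bsub>pair_group D\<^esub> x = \<one>\<^bsub>pair_group D\<^esub>"
      using sum c0 unfolding abc by (simp add: pair_group_def qmul_def algebra_simps)
    ultimately show ?thesis by blast
  qed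
qed (auto simp: pair_group_def qmul_def qunits_def qnorm_def algebra_simps)

lemma comm_group_Z1: "comm_group (Z1_group e D)"
proof (rule comm_groupI)
  fix \<sigma> \<tau> assume \<sigma>: "\<sigma> \<in> carrier (Z1_group e D)" and \<tau>: "\<tau> \<in> carrier (Z1_group e D)"
  obtain S T where ST: "finite S" "\<forall>g\<in>galK e. (\<forall>s\<in>S. g s = s) \<longrightarrow> \<sigma> g = 0"
    "finite T" "\<forall>g\<in>galK e. (\<forall>s\<in>T. g s = s) \<longrightarrow> \<tau> g = 0"
    using \<sigma> \<tau> unfolding Z1_group_def Z1_def by auto
  have "\<exists>S. finite S \<and> (\<forall>g\<in>galK e. (\<forall>s\<in>S. g s = s) \<longrightarrow> \<sigma> g + \<tau> g = 0)"
    using ST by (intro exI[of _ "S \<union> T"]) auto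
  then show "\<sigma> \<otimes>\<^bsub>Z1_group e D\<^esub> \<tau> \<in> carrier (Z1_group e D)"
    using \<sigma> \<tau> by (simp add: Z1_group_def Z1_def algebra_simps)
  show "\<sigma> \<otimes>\<^bsub>Z1_group e D\<^esub> \<tau> = \<tau> \<otimes>\<^bsub>Z1_group e D\<^esub> \<sigma>"
    by (simp add: Z1_group_def add.commute)
  have "(\<lambda>g. - \<sigma> g) \<in> carrier (Z1_group e D)"
    using \<sigma> by (simp add: Z1_group_def Z1_def)
  then show "\<exists>\<tau>\<in>carrier (Z1_group e D). \<tau> \<otimes>\<^bsub>Z1_group e D\<^esub> \<sigma> = \<one>\<^bsub>Z1_group e D\<^esub>"
    by (rule bexI[rotated]) (simp add: Z1_group_def)
qed (auto simp: Z1_group_def Z1_def add.assoc)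

lemma subgroup_B1: "subgroup (B1 e D) (Z1_group e D)"
proof -
  interpret Z: comm_group "Z1_group e D" by (rule comm_group_Z1)
  define \<delta> where "\<delta> m = (\<lambda>g. if g \<in> galK e then \<chi> g * m - m else 0)" for m
  have B1: "B1 e D = range \<delta>" unfolding B1_def \<delta>_def by auto
  have add: "(\<lambda>g. \<delta> m g + \<delta> n g) = \<delta> (m + n)" for m n
    by (auto simp: \<delta>_def algebra_simps)
  have zero: "\<delta> 0 = (\<lambda>_. 0)" by (auto simp: \<delta>_def)
  have Z1: "\<delta> m \<in> Z1 e D" for m
  proof -
    \<comment> \<open>An automorphism fixing the square root i r of D has \<open>\<chi> g\<close> =
      1, so coboundaries are continuous.\<close>
    have "\<delta> m g = 0" if "g \<in> galK e" "\<forall>s\<in>{i * r}. g s = s" for g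
      using that by (simp add: \<delta>_def chiD_eq)
    then have "\<exists>S. finite S \<and> (\<forall>g\<in>galK e. (\<forall>s\<in>S. g s = s) \<longrightarrow> \<delta> m g = 0)"
      by (intro exI[of _ "{i * r}"]) blast
    then show ?thesis
      by (simp add: Z1_def) (auto simp: \<delta>_def galK_comp chiD_comp algebra_simps)
  qed
  show ?thesis
  proof (rule Z.subgroupI)
    show "B1 e D \<subseteq> carrier (Z1_group e D)" using Z1 unfolding B1 by (auto simp: Z1_group_def)
    show "B1 e D \<noteq> {}" unfolding B1 by blast
    fix a assume "a \<in> B1 e D"
    then obtain m where m: "a = \<delta> m" unfolding B1 by blast
    have "inv\<^bsub>Z1_group e D\<^esub> a = \<delta> (- m)"
    proof (rule Z.inv_equality)
      show "\<delta> (- m) \<otimes>\<^bsub>Z1_group e D\<^esub> a = \<one>\<^bsub>Z1_group e D\<^esub>"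
        unfolding m by (simp add: Z1_group_def add zero)
    qed (use Z1 m in \<open>simp_all add: Z1_group_def\<close>)
    then show "inv\<^bsub>Z1_group e D\<^esub> a \<in> B1 e D" unfolding B1 by blast
    fix b assume "b \<in> B1 e D"
    then obtain n where n: "b = \<delta> n" unfolding B1 by blast
    show "a \<otimes>\<^bsub>Z1_group e D\<^esub> b \<in> B1 e D"
      unfolding m n B1 using add by (simp add: Z1_group_def)
  qed
qed

text \<open>First isomorphism theorem for the map sending a pair to the class of its cocycle. The
  second conjunct keeps a Kummer cocycle in each image coset, ready for
  \<open>kummer_corresponds\<close>.\<close>

theorem pair_quot_iso_H1:
  "\<exists>\<phi>. \<phi> \<in> iso (pair_quot D) (H1 e D)
     \<and> (\<forall>p\<in>carrier (pair_group D).
         \<exists>w. \<exists>\<sigma>\<in>\<phi> (pair_sub D #>\<^bsub>pair_group D\<^esub> p). kummer p w \<sigma>)"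
proof -
  let ?P = "pair_group D" and ?Z = "Z1_group e D"
  interpret P: comm_group ?P by (rule comm_group_pair_group)
  interpret Z: comm_group ?Z by (rule comm_group_Z1)
  interpret B: normal "B1 e D" ?Z
    using subgroup_B1 Z.normal_iff_subgroup by simp
  have carrier_Z: "carrier ?Z = Z1 e D" by (simp add: Z1_group_def)
  \<comment> \<open>An arbitrary choice of root and cocycle; \<open>coset_eq\<close> shows that its
    class does not depend on it.\<close>
  define coc where "coc p = (SOME \<sigma>. \<exists>w. kummer p w \<sigma>)" for p
  have coc: "\<exists>w. kummer p w (coc p)" if "p \<in> carrier ?P" for p
  proof -
    have "\<exists>\<sigma> w. kummer p w \<sigma>" using kummer_exists[OF that] by blast
    then show ?thesis unfolding coc_def by (rule someI_ex)
  qed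
  define h where "h p = B1 e D #>\<^bsub>?Z\<^esub> coc p" for p
  have coset_eq: "h p = B1 e D #>\<^bsub>?Z\<^esub> \<sigma>" if p: "p \<in> carrier ?P" and k: "kummer p w \<sigma>" for p w \<sigma>
  proof -
    obtain z where z: "kummer p z (coc p)" using coc[OF p] by blast
    obtain b where "b \<in> B1 e D" "coc p = (\<lambda>g. b g + \<sigma> g)" using kummer_unique[OF p k z] by blast
    then have "coc p \<in> B1 e D #>\<^bsub>?Z\<^esub> \<sigma>" unfolding r_coset_def by (auto simp: Z1_group_def)
    then show ?thesis
      unfolding h_def using kummer_in_Z1[OF p k] carrier_Z
      by (metis Z.repr_independence subgroup_B1)
  qed
  have hom: "h \<in> hom ?P (H1 e D)"
  proof (rule homI)
    fix p q assume p: "p \<in> carrier ?P" and q: "q \<in> carrier ?P"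
    obtain w z where wz: "kummer p w (coc p)" "kummer q z (coc q)" using coc p q by blast
    have Z: "coc p \<in> carrier ?Z" "coc q \<in> carrier ?Z"
      using kummer_in_Z1[OF p wz(1)] kummer_in_Z1[OF q wz(2)] carrier_Z by auto
    show "h p \<in> carrier (H1 e D)"
      unfolding h_def H1_def FactGroup_def RCOSETS_def using Z by auto
    have "h (p \<otimes>\<^bsub>?P\<^esub> q) = B1 e D #>\<^bsub>?Z\<^esub> (coc p \<otimes>\<^bsub>?Z\<^esub> coc q)"
      using coset_eq[OF P.m_closed[OF p q] kummer_mult[OF wz]] by (simp add: Z1_group_def)
    also have "\<dots> = h p \<otimes>\<^bsub>H1 e D\<^esub> h q"
      unfolding h_def H1_def using Z by (simp add: FactGroup_def B.rcos_sum)
    finally show "h (p \<otimes>\<^bsub>?P\<^esub> q) = h p \<otimes>\<^bsub>H1 e D\<^esub> h q" .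
  qed
  have H1: "group (H1 e D)" unfolding H1_def by (rule B.factorgroup_is_group)
  interpret h: group_hom ?P "H1 e D" h
    by (rule group_hom.intro) (use H1 P.group_axioms hom in \<open>auto simp: group_hom_axioms_def\<close>)
  have one: "\<one>\<^bsub>H1 e D\<^esub> = B1 e D" by (simp add: H1_def FactGroup_def)
  have B1_coset: "B1 e D #>\<^bsub>?Z\<^esub> (\<lambda>_. 0) = B1 e D"
    using B.subset by (simp add: r_coset_def Z1_group_def)
  have sub_carrier: "p \<in> carrier ?P" if ps: "p \<in> pair_sub D" for p
  proof -
    obtain \<beta> where \<beta>: "\<beta> \<in> qunits D" and p: "p = (qpow4 D \<beta>, qnorm D \<beta>)"
      using ps unfolding pair_sub_def by blast
    \<comment> \<open>In the separable closure the norm is the product of the two values, and fourth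
      powers distribute over it.\<close>
    have "e (qnorm D (qpow4 D \<beta>)) = e (qnorm D \<beta> ^ 4)"
      unfolding emb_power val_mult_cval[symmetric] val_qpow4 by (simp add: power_mult_distrib)
    then have "qnorm D (qpow4 D \<beta>) = qnorm D \<beta> ^ 4" by (simp del: emb_power)
    then show ?thesis using \<beta> unfolding p by (simp add: pair_group_def qunits_def)
  qed
  have ker: "kernel ?P (H1 e D) h = pair_sub D"
  proof (intro equalityI subsetI)
    fix p assume "p \<in> kernel ?P (H1 e D) h"
    then have p: "p \<in> carrier ?P" and hp: "h p = B1 e D" unfolding kernel_def one by auto
    obtain w where w: "kummer p w (coc p)" using coc[OF p] by blast
    have "coc p \<in> h p"
      unfolding h_def using kummer_in_Z1[OF p w] carrier_Z Z.rcos_self subgroup_B1 by blast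
    then have "coc p \<in> B1 e D" using hp by simp
    then obtain m where m: "coc p = (\<lambda>g. if g \<in> galK e then \<chi> g * m - m else 0)"
      unfolding B1_def by blast
    \<comment> \<open>The coboundary of m is removed by passing from the root w to i^(-m) w, which
      leaves the trivial cocycle.\<close>
    have "(\<lambda>g. coc p g + (if g \<in> galK e then \<chi> g * (- m) - (- m) else 0)) = (\<lambda>_. 0)"
      unfolding m by auto
    then have "kummer p (pw (- m) * w) (\<lambda>_. 0)" using kummer_shift[OF w, of "- m"] by simp
    then show "p \<in> pair_sub D" by (rule kummer_trivial_imp_pair_sub[OF p])
  next
    fix p assume "p \<in> pair_sub D"
    then have p: "p \<in> carrier ?P" and "\<exists>w. kummer p w (\<lambda>_. 0)"
      using sub_carrier kummer_pair_sub by blast+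
    then have "h p = B1 e D" using coset_eq[OF p] B1_coset by metis
    then show "p \<in> kernel ?P (H1 e D) h" unfolding kernel_def one using p by simp
  qed
  have surj: "h ` carrier ?P = carrier (H1 e D)"
  proof (intro equalityI subsetI)
    fix X assume "X \<in> carrier (H1 e D)"
    then obtain \<sigma> where \<sigma>: "\<sigma> \<in> Z1 e D" "X = B1 e D #>\<^bsub>?Z\<^esub> \<sigma>"
      unfolding H1_def FactGroup_def RCOSETS_def carrier_Z by auto
    then obtain p w where "p \<in> carrier ?P" "kummer p w \<sigma>" using kummer_surj by blast
    then show "X \<in> h ` carrier ?P" using coset_eq \<sigma>(2) by blast
  qed (use h.hom_closed in blast)
  \<comment> \<open>The common value of \<open>h\<close> on a coset of its kernel, that is, the map
    induced on the quotient.\<close>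
  define \<phi> where "\<phi> X = the_elem (h ` X)" for X
  have "\<phi> \<in> iso (pair_quot D) (H1 e D)"
    using h.FactGroup_iso_set[OF surj] unfolding pair_quot_def ker \<phi>_def .
  moreover have "\<exists>w. \<exists>\<sigma>\<in>\<phi> (pair_sub D #>\<^bsub>?P\<^esub> p). kummer p w \<sigma>" if p: "p \<in> carrier ?P" for p
  proof -
    have const: "h q = h p" if q: "q \<in> pair_sub D #>\<^bsub>?P\<^esub> p" for q
    proof -
      obtain s where s: "s \<in> kernel ?P (H1 e D) h" "q = s \<otimes>\<^bsub>?P\<^esub> p"
        using q unfolding ker r_coset_def by blast
      then show ?thesis using p by (simp add: kernel_def)
    qed
    have "p \<in> pair_sub D #>\<^bsub>?P\<^esub> p"
      using P.rcos_self[OF p h.subgroup_kernel] unfolding ker .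
    then have "pair_sub D #>\<^bsub>?P\<^esub> p \<noteq> {}" by blast
    then have "\<phi> (pair_sub D #>\<^bsub>?P\<^esub> p) = h p"
      unfolding \<phi>_def using const by (rule the_elem_image_unique)
    moreover obtain w where w: "kummer p w (coc p)" using coc[OF p] by blast
    moreover have "coc p \<in> h p"
      unfolding h_def using kummer_in_Z1[OF p w] carrier_Z Z.rcos_self subgroup_B1 by blast
    ultimately show ?thesis by blast
  qed
  ultimately show ?thesis by blast
qed

end

text \<open>The cardinality condition expresses that L is etale of degree 4: its four coordinates
  are distinct and can be labelled bijectively by Z/4.\<close>

theorem theorem5p5:
  fixes e :: "'k::field \<Rightarrow> 'o::field" and D :: 'k
  assumes char: "(2::'k) \<noteq> 0"
    and D: "D \<noteq> 0"
    and sep: "is_sep_closure e"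
  shows "\<exists>\<phi>. \<phi> \<in> iso (pair_quot D) (H1 e D)
     \<and> (\<forall>a b c. ((a, b), c) \<in> carrier (pair_group D) \<longrightarrow> card (L_coords e a c) = 4 \<longrightarrow>
           (\<exists>\<sigma>\<in>\<phi> (pair_sub D #>\<^bsub>pair_group D\<^esub> ((a, b), c)).
               corresponds e D \<sigma> (L_coords e a c)))"
proof -
  interpret sep_closure e by standard (rule sep)
  obtain r i where "r ^ 2 = - e D" "i ^ 2 = - (1::'o)" using sqrt_exists[OF char] by metis
  then interpret quadratic_twist e D r i using char D by unfold_locales
  show ?thesis using pair_quot_iso_H1 kummer_corresponds by metis
qed

end
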